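(* (Weak associativity.) Let $(V,Y(\cdot,(x,\varphi^+,\varphi^-)),\mathbf{1})$ be an $N=2$ vertex superalgebra with two odd formal variables. Then for $u,w\in V$ there exists a positive integer $k$ such that for any $v\in V$ $$(x_0+x_2+\varphi_1^+\varphi_2^-+\varphi_1^-\varphi_2^+)^kY(Y(u,(x_0,\varphi_1^+-\varphi_2^+,\varphi_1^--\varphi_2^-))v,(x_2,\varphi_2^+,\varphi_2^-))w$$ $$=(x_0+x_2+\varphi_1^+\varphi_2^-+\varphi_1^-\varphi_2^+)^kY(u,(x_0+x_2+\varphi_1^+\varphi_2^-+\varphi_1^-\varphi_2^+,\varphi_1^+,\varphi_1^-))Y(v,(x_2,\varphi_2^+,\varphi_2^-))w.$$ Furthermore, this weak associativity follows from the truncation condition and the Jacobi identity.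
   Context: Grassmann algebra: $\bigwedge_L$ ($L\in\mathbb{N}$) is the exterior algebra over $\mathbb{C}$ on $L$ generators, $\bigwedge_L\subset\bigwedge_{L+1}$, $\bigwedge_\infty=\bigcup_L\bigwedge_L$; $\bigwedge_*$ is one of these, with even and odd parts $\bigwedge_*^0,\bigwedge_*^1$. For $V=V^0\oplus V^1$ write $\eta(v)=j$ if $v\in V^j$. Formal variables: $x,x_0,x_1,x_2$ are even (commute with everything); $\varphi^\pm,\varphi_1^\pm,\varphi_2^\pm$ are odd (commute with even variables and even elements; anticommute with each other, with $\bigwedge_*^1$ and with odd endomorphisms; squares vanish). $\delta(x)=\sum_{n\in\mathbb{Z}}x^n$; expressions containing products of odd variables are Taylor expanded about the even variables, and powers of a sum of two even variables are expanded in nonnegative powers of the second one, e.g. $\delta\big(\frac{x_1-x_2-\nu}{x_0}\big)=\sum_n(x_1-x_2-\nu)^nx_0^{-n}$, and $Y(u,(x_0+x_2+\nu,\cdot,\cdot))$ is expanded in nonnegative powers of $x_2$. An $N=2$ vertex superalgebra over $\bigwedge_*$ with two odd formal variables, $(V,Y(\cdot,(x,\varphi^+,\varphi^-)),\mathbf{1})$, consists of a $\mathbb{Z}_2$-graded $\bigwedge_*$-module $V=V^0\oplus V^1$, a linear map $v\mapsto Y(v,(x,\varphi^+,\varphi^-))=\sum_{n\in\mathbb{Z}}(v_n+\varphi^+v^+_{n-\frac12}+\varphi^-v^-_{n-\frac12}+\varphi^+\varphi^-v^{+-}_{n-1})x^{-n-1}\in(\mathrm{End}\,V)[[x,x^{-1}]][\varphi^+,\varphi^-]$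 with $v_n,v^{+-}_n\in(\mathrm{End}\,V)^{\eta(v)}$ and $v^\pm_{n-\frac12}\in(\mathrm{End}\,V)^{\eta(v)+1\bmod2}$ for homogeneous $v$, and $\mathbf{1}\in V$, such that for $u,v\in V$: (truncation) $u_nv=u^{+-}_nv=u^\pm_{n-\frac12}v=0$ for $n$ sufficiently large; (vacuum) $Y(\mathbf{1},(x,\varphi^+,\varphi^-))=\mathrm{id}_V$; (creation) $Y(v,(x,\varphi^+,\varphi^-))\mathbf{1}\in V[[x]][\varphi^+,\varphi^-]$ and its value at $(x,\varphi^+,\varphi^-)=0$ is $v$; (Jacobi identity) for $u,v$ of homogeneous sign $$x_0^{-1}\delta\Big(\tfrac{x_1-x_2-\varphi_1^+\varphi_2^--\varphi_1^-\varphi_2^+}{x_0}\Big)Y(u,(x_1,\varphi_1^+,\varphi_1^-))Y(v,(x_2,\varphi_2^+,\varphi_2^-))-(-1)^{\eta(u)\eta(v)}x_0^{-1}\delta\Big(\tfrac{x_2-x_1+\varphi_1^+\varphi_2^-+\varphi_1^-\varphi_2^+}{-x_0}\Big)Y(v,(x_2,\varphi_2^+,\varphi_2^-))Y(u,(x_1,\varphi_1^+,\varphi_1^-))$$ $$=x_2^{-1}\delta\Big(\tfrac{x_1-x_0-\varphi_1^+\varphi_2^--\varphi_1^-\varphi_2^+}{x_2}\Big)Y(Y(u,(x_0,\varphi_1^+-\varphi_2^+,\varphi_1^--\varphi_2^-))v,(x_2,\varphi_2^+,\varphi_2^-)).$$ *)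

theory Defs
  imports
    Complex_Main
    "HOL-Library.Z2"
    "HOL-Library.Extended_Nat"
    "HOL-Library.Function_Algebras"
    "HOL-Library.Groups_Big_Fun"
begin

section \<open>Exterior monomials and the Grassmann algebras\<close>

text \<open>
  In an exterior algebra on linearly ordered generators, the monomial of a finite set \<open>S\<close> is the
  product of its elements in increasing order.  The product of the monomials of \<open>S\<close> and \<open>T\<close> is
  zero if they meet, and otherwise \<open>ext_sgn S T\<close> times the monomial of \<open>S \<union> T\<close>.  The same sign
  serves for the generators of the Grassmann algebra and for the odd formal variables.
\<close>

definition ext_sgn :: "'g::linorder set \<Rightarrow> 'g set \<Rightarrow> complex" where
  "ext_sgn S T = (if S \<inter> T = {} then (-1) ^ card {(s, t). s \<in> S \<and> t \<in> T \<and> t < s} else 0)"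

lemma ext_sgn_empty [simp]: "ext_sgn {} T = 1" "ext_sgn S {} = 1"
  by (simp_all add: ext_sgn_def)

lemma ext_sgn_Un_left:
  assumes "finite R" "finite Q" "finite W" "R \<inter> Q = {}"
  shows "ext_sgn (R \<union> Q) W = ext_sgn R W * ext_sgn Q W"
proof -
  let ?I = "\<lambda>S T. {(s, t). s \<in> S \<and> t \<in> T \<and> t < s}"
  have fin: "finite (?I A B)" if "finite A" "finite B" for A B :: "'a set"
    by (rule finite_subset[of _ "A \<times> B"]) (use that in auto)
  have "?I (R \<union> Q) W = ?I R W \<union> ?I Q W" "?I R W \<inter> ?I Q W = {}"
    using assms by auto
  then have "card (?I (R \<union> Q) W) = card (?I R W) + card (?I Q W)"
    using card_Un_disjoint[of "?I R W" "?I Q W"] fin assms by simp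
  moreover have "(R \<union> Q) \<inter> W = {} \<longleftrightarrow> R \<inter> W = {} \<and> Q \<inter> W = {}" by blast
  ultimately show ?thesis
    unfolding ext_sgn_def by (simp add: power_add)
qed

lemma ext_sgn_Un_right:
  assumes "finite R" "finite Q" "finite W" "Q \<inter> W = {}"
  shows "ext_sgn R (Q \<union> W) = ext_sgn R Q * ext_sgn R W"
proof -
  let ?I = "\<lambda>S T. {(s, t). s \<in> S \<and> t \<in> T \<and> t < s}"
  have fin: "finite (?I A B)" if "finite A" "finite B" for A B :: "'a set"
    by (rule finite_subset[of _ "A \<times> B"]) (use that in auto)
  have "?I R (Q \<union> W) = ?I R Q \<union> ?I R W" "?I R Q \<inter> ?I R W = {}"
    using assms by auto
  then have "card (?I R (Q \<union> W)) = card (?I R Q) + card (?I R W)"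
    using card_Un_disjoint[of "?I R Q" "?I R W"] fin assms by simp
  moreover have "R \<inter> (Q \<union> W) = {} \<longleftrightarrow> R \<inter> Q = {} \<and> R \<inter> W = {}" by blast
  ultimately show ?thesis
    unfolding ext_sgn_def by (simp add: power_add)
qed

definition ext_mult :: "('g::linorder set \<Rightarrow> complex) \<Rightarrow> ('g set \<Rightarrow> complex) \<Rightarrow> 'g set \<Rightarrow> complex" where
  "ext_mult f g U = (\<Sum>T\<in>Pow U. ext_sgn T (U - T) * f T * g (U - T))"

lemma ext_mult_assoc:
  assumes U: "finite U"
  shows "ext_mult (ext_mult f g) h U = ext_mult f (ext_mult g h) U"
proof -
  let ?A = "SIGMA T:Pow U. Pow T" and ?B = "SIGMA R:Pow U. Pow (U - R)"
  let ?F = "\<lambda>(T, R). ext_sgn T (U - T) * (ext_sgn R (T - R) * f R * g (T - R)) * h (U - T)"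
  let ?G = "\<lambda>(R, Q). ext_sgn R (U - R) * f R * (ext_sgn Q (U - R - Q) * g Q * h (U - R - Q))"
  have fin: "finite T" if "T \<subseteq> U" for T using that U finite_subset by blast
  have "ext_mult (ext_mult f g) h U = sum ?F ?A"
    unfolding ext_mult_def using U fin
    by (subst sum.Sigma[symmetric]) (auto simp: sum_distrib_left sum_distrib_right)
  also have "\<dots> = sum ?G ?B"
  proof (rule sum.reindex_bij_witness[where i = "\<lambda>(R, Q). (R \<union> Q, R)" and j = "\<lambda>(T, R). (R, T - R)"])
    fix a assume "a \<in> ?A"
    then obtain T R where a: "a = (T, R)" "R \<subseteq> T" "T \<subseteq> U" by auto
    have TR: "T = R \<union> (T - R)" and UR: "U - R = (T - R) \<union> (U - T)" and W: "U - R - (T - R) = U - T"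
      using a by auto
    have 1: "ext_sgn T (U - T) = ext_sgn R (U - T) * ext_sgn (T - R) (U - T)"
      by (subst TR, rule ext_sgn_Un_left) (use a fin U in \<open>auto intro: finite_subset\<close>)
    have 2: "ext_sgn R (U - R) = ext_sgn R (T - R) * ext_sgn R (U - T)"
      by (subst UR, rule ext_sgn_Un_right) (use a fin U in \<open>auto intro: finite_subset\<close>)
    show "?G (case a of (T, R) \<Rightarrow> (R, T - R)) = ?F a"
      unfolding a(1) prod.case W 1 2 by (simp add: mult_ac)
  qed auto
  also have "\<dots> = ext_mult f (ext_mult g h) U"
    unfolding ext_mult_def using U fin
    by (subst sum.Sigma[symmetric]) (auto simp: sum_distrib_left sum_distrib_right)
  finally show ?thesis .
qed

text \<open>
  The type \<open>grassmann\<close> is the union of the exterior algebras over the complex numbers on finitely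
  many of the generators \<open>0, 1, 2, \<dots>\<close>; an element is given by its coefficients.
\<close>

typedef grassmann =
  "{f :: nat set \<Rightarrow> complex. finite {S. f S \<noteq> 0} \<and> (\<forall>S. f S \<noteq> 0 \<longrightarrow> finite S)}"
  morphisms gcoeff Grassmann
  by (rule exI[of _ "\<lambda>_. 0"]) simp

lemma grassmann_eqI: "(\<And>S. finite S \<Longrightarrow> gcoeff a S = gcoeff b S) \<Longrightarrow> a = b"
  by (rule iffD1[OF gcoeff_inject], rule ext) (metis (mono_tags, lifting) gcoeff mem_Collect_eq)

lemma finite_gcoeff: "finite {S. gcoeff a S \<noteq> 0}"
  and gcoeff_infinite: "infinite S \<Longrightarrow> gcoeff a S = 0"
  using gcoeff[of a] by auto

definition gconst :: "complex \<Rightarrow> grassmann" where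
  "gconst c = Grassmann (\<lambda>S. if S = {} then c else 0)"

lemma gcoeff_gconst: "gcoeff (gconst c) S = (if S = {} then c else 0)"
  unfolding gconst_def by (subst Grassmann_inverse) (auto intro: finite_subset[of _ "{{}}"])

instantiation grassmann :: ring_1
begin

definition "0 = gconst 0"
definition "1 = gconst 1"
definition "a + b = Grassmann (\<lambda>S. gcoeff a S + gcoeff b S)"
definition "a - b = Grassmann (\<lambda>S. gcoeff a S - gcoeff b S)"
definition "- a = Grassmann (\<lambda>S. - gcoeff a S)"
definition "a * b = Grassmann (ext_mult (gcoeff a) (gcoeff b))"

lemma gcoeff_0: "gcoeff 0 S = 0"
  by (simp add: zero_grassmann_def gcoeff_gconst)

lemma gcoeff_1: "gcoeff 1 S = (if S = {} then 1 else 0)"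
  by (simp add: one_grassmann_def gcoeff_gconst)

lemma gcoeff_add: "gcoeff (a + b) S = gcoeff a S + gcoeff b S"
proof -
  have "finite {S. gcoeff a S + gcoeff b S \<noteq> 0}"
    by (rule finite_subset[OF _ finite_UnI[OF finite_gcoeff[of a] finite_gcoeff[of b]]]) auto
  moreover have "finite S" if "gcoeff a S + gcoeff b S \<noteq> 0" for S
    using that by (cases "finite S") (simp_all add: gcoeff_infinite)
  ultimately show ?thesis
    unfolding plus_grassmann_def by (subst Grassmann_inverse) auto
qed

lemma gcoeff_diff: "gcoeff (a - b) S = gcoeff a S - gcoeff b S"
proof -
  have "finite {S. gcoeff a S - gcoeff b S \<noteq> 0}"
    by (rule finite_subset[OF _ finite_UnI[OF finite_gcoeff[of a] finite_gcoeff[of b]]]) auto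
  moreover have "finite S" if "gcoeff a S - gcoeff b S \<noteq> 0" for S
    using that by (cases "finite S") (simp_all add: gcoeff_infinite)
  ultimately show ?thesis
    unfolding minus_grassmann_def by (subst Grassmann_inverse) auto
qed

lemma gcoeff_uminus: "gcoeff (- a) S = - gcoeff a S"
  unfolding uminus_grassmann_def
  by (subst Grassmann_inverse) (use finite_gcoeff[of a] gcoeff_infinite[of _ a] in auto)

lemma gcoeff_mult: "gcoeff (a * b) = ext_mult (gcoeff a) (gcoeff b)"
proof -
  let ?p = "ext_mult (gcoeff a) (gcoeff b)"
  have nz: "\<exists>T\<in>Pow S. gcoeff a T \<noteq> 0 \<and> gcoeff b (S - T) \<noteq> 0" if S: "?p S \<noteq> 0" for S
  proof (rule ccontr)
    assume "\<not> ?thesis"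
    then have "\<forall>T\<in>Pow S. ext_sgn T (S - T) * gcoeff a T * gcoeff b (S - T) = 0" by auto
    then have "?p S = 0" unfolding ext_mult_def by (simp add: sum.neutral)
    with S show False by simp
  qed
  have "{S. ?p S \<noteq> 0} \<subseteq> (\<lambda>(T, R). T \<union> R) ` ({S. gcoeff a S \<noteq> 0} \<times> {S. gcoeff b S \<noteq> 0})"
  proof
    fix S assume "S \<in> {S. ?p S \<noteq> 0}"
    then obtain T where T: "T \<subseteq> S" "gcoeff a T \<noteq> 0" "gcoeff b (S - T) \<noteq> 0" using nz by auto
    then have "S = T \<union> (S - T)" by auto
    with T show "S \<in> (\<lambda>(T, R). T \<union> R) ` ({S. gcoeff a S \<noteq> 0} \<times> {S. gcoeff b S \<noteq> 0})"
      by (intro image_eqI[where x = "(T, S - T)"]) auto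
  qed
  then have "finite {S. ?p S \<noteq> 0}"
    by (rule finite_subset) (simp add: finite_gcoeff)
  moreover have "finite S" if "?p S \<noteq> 0" for S
    using that unfolding ext_mult_def by (metis finite_Pow_iff sum.infinite)
  ultimately show ?thesis
    unfolding times_grassmann_def by (subst Grassmann_inverse) auto
qed

instance
proof
  fix a b c :: grassmann
  show "a * b * c = a * (b * c)"
    by (rule grassmann_eqI) (simp add: gcoeff_mult ext_mult_assoc)
  show "(a + b) * c = a * c + b * c" "a * (b + c) = a * b + a * c"
    by (rule grassmann_eqI;
        simp add: gcoeff_mult gcoeff_add ext_mult_def sum.distrib algebra_simps)+
  show "1 * a = a"
  proof (rule grassmann_eqI)
    fix S :: "nat set" assume "finite S"
    then have "ext_mult (gcoeff 1) (gcoeff a) S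
        = (\<Sum>T\<in>Pow S. if T = {} then gcoeff a S else 0)"
      unfolding ext_mult_def by (intro sum.cong) (auto simp: gcoeff_1)
    with \<open>finite S\<close> show "gcoeff (1 * a) S = gcoeff a S" by (simp add: gcoeff_mult)
  qed
  show "a * 1 = a"
  proof (rule grassmann_eqI)
    fix S :: "nat set" assume "finite S"
    then have "ext_mult (gcoeff a) (gcoeff 1) S
        = (\<Sum>T\<in>Pow S. if T = S then gcoeff a S else 0)"
      unfolding ext_mult_def by (intro sum.cong) (auto simp: gcoeff_1)
    with \<open>finite S\<close> show "gcoeff (a * 1) S = gcoeff a S" by (simp add: gcoeff_mult)
  qed
  show "(0::grassmann) \<noteq> 1"
    by (metis gcoeff_0 gcoeff_1 zero_neq_one)
qed (rule grassmann_eqI; simp add: gcoeff_0 gcoeff_add gcoeff_diff gcoeff_uminus)+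

end

text \<open>\<open>Grass L\<close> is the Grassmann algebra on \<open>L\<close> generators, \<open>Grass \<infinity>\<close> the union of all of them.\<close>

definition Grass :: "enat \<Rightarrow> grassmann set" where
  "Grass L = {a. \<forall>S. gcoeff a S \<noteq> 0 \<longrightarrow> (\<forall>i\<in>S. enat i < L)}"

definition Grass_part :: "enat \<Rightarrow> bit \<Rightarrow> grassmann set" where
  "Grass_part L j = {a \<in> Grass L. \<forall>S. gcoeff a S \<noteq> 0 \<longrightarrow> of_nat (card S) = j}"


section \<open>Graded modules and their endomorphisms\<close>

text \<open>\<open>koszul b x\<close> is \<open>(-1)\<^sup>b x\<close>.\<close>

definition koszul :: "bit \<Rightarrow> 'a::group_add \<Rightarrow> 'a" where
  "koszul b x = (if b = 1 then - x else x)"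

text \<open>
  The module is the whole type \<open>'v\<close>, and \<open>V j\<close> is its part of sign \<open>j\<close>.  Only the action of
  elements of \<open>Grass L\<close> is constrained.
\<close>

locale graded_module =
  fixes L :: enat
    and act :: "grassmann \<Rightarrow> 'v::ab_group_add \<Rightarrow> 'v"
    and V :: "bit \<Rightarrow> 'v set"
  assumes act_one: "act 1 z = z"
    and act_mult: "\<lbrakk>a \<in> Grass L; b \<in> Grass L\<rbrakk> \<Longrightarrow> act (a * b) z = act a (act b z)"
    and act_add_left: "\<lbrakk>a \<in> Grass L; b \<in> Grass L\<rbrakk> \<Longrightarrow> act (a + b) z = act a z + act b z"
    and act_add_right: "a \<in> Grass L \<Longrightarrow> act a (y + z) = act a y + act a z"
    and part_zero: "0 \<in> V j"
    and part_add: "\<lbrakk>y \<in> V j; z \<in> V j\<rbrakk> \<Longrightarrow> y + z \<in> V j"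
    and part_act: "\<lbrakk>a \<in> Grass_part L i; z \<in> V j\<rbrakk> \<Longrightarrow> act a z \<in> V (i + j)"
    and direct_sum: "\<exists>!(z0, z1). z0 \<in> V 0 \<and> z1 \<in> V 1 \<and> z = z0 + z1"

definition cscale :: "(grassmann \<Rightarrow> 'v \<Rightarrow> 'v) \<Rightarrow> complex \<Rightarrow> 'v \<Rightarrow> 'v" where
  "cscale act c = act (gconst c)"

text \<open>Endomorphisms of sign \<open>j\<close>: an odd one anticommutes with odd elements of the Grassmann algebra.\<close>

definition End_part ::
  "enat \<Rightarrow> (grassmann \<Rightarrow> 'v::ab_group_add \<Rightarrow> 'v) \<Rightarrow> (bit \<Rightarrow> 'v set) \<Rightarrow> bit \<Rightarrow> ('v \<Rightarrow> 'v) set" where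
  "End_part L act V j = {f.
     (\<forall>y z. f (y + z) = f y + f z) \<and>
     (\<forall>i. \<forall>a\<in>Grass_part L i. \<forall>z. f (act a z) = koszul (i * j) (act a (f z))) \<and>
     (\<forall>i. \<forall>z\<in>V i. f z \<in> V (i + j))}"

definition grade_inv :: "(bit \<Rightarrow> 'v::ab_group_add set) \<Rightarrow> 'v \<Rightarrow> 'v" where
  "grade_inv V z = (THE y. \<exists>z0\<in>V 0. \<exists>z1\<in>V 1. z = z0 + z1 \<and> y = z0 - z1)"


section \<open>Formal series\<close>

datatype evar = X0 | X1 | X2

datatype pm = Plus | Minus

datatype ovar = Phi1 pm | Phi2 pm

instance pm :: finite
proof
  have "(UNIV :: pm set) \<subseteq> {Plus, Minus}" by (auto intro: pm.exhaust)
  then show "finite (UNIV :: pm set)" by (rule finite_subset) simp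
qed

fun ovar_index :: "ovar \<Rightarrow> nat" where
  "ovar_index (Phi1 Plus) = 0"
| "ovar_index (Phi1 Minus) = 1"
| "ovar_index (Phi2 Plus) = 2"
| "ovar_index (Phi2 Minus) = 3"

lemma ovar_index_inject: "ovar_index p = ovar_index q \<Longrightarrow> p = q"
  by (cases p rule: ovar_index.cases; cases q rule: ovar_index.cases) simp_all

instantiation ovar :: linorder
begin
definition "p \<le> q \<longleftrightarrow> ovar_index p \<le> ovar_index q"
definition "p < q \<longleftrightarrow> ovar_index p < ovar_index q"
instance
  by standard (auto simp: less_eq_ovar_def less_ovar_def intro: ovar_index_inject)
end

instance ovar :: finite
proof
  have "finite (ovar_index -` {..3} \<inter> UNIV)"
    by (rule finite_vimage_IntI) (auto intro: injI ovar_index_inject)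
  moreover have "ovar_index p \<le> 3" for p
    by (cases p rule: ovar_index.cases) simp_all
  then have "ovar_index -` {..3} \<inter> UNIV = UNIV" by auto
  ultimately show "finite (UNIV :: ovar set)" by simp
qed

text \<open>
  A series \<open>F\<close> stands for the sum over \<open>m\<close> and \<open>S\<close> of
  \<open>x\<^sub>0^m(X0) x\<^sub>1^m(X1) x\<^sub>2^m(X2) \<phi>\<^sub>S F m S\<close>, where \<open>\<phi>\<^sub>S\<close> is the product of the odd variables
  in \<open>S\<close>, in the order \<open>\<phi>\<^sub>1\<^sup>+, \<phi>\<^sub>1\<^sup>-, \<phi>\<^sub>2\<^sup>+, \<phi>\<^sub>2\<^sup>-\<close>, and stands to the left of its coefficient.
  Infinite sums of series are taken coefficientwise by \<^const>\<open>Sum_any\<close>; in every use below the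
  truncation condition leaves only finitely many nonzero terms.
\<close>

type_synonym 'b series = "(evar \<Rightarrow> int) \<Rightarrow> ovar set \<Rightarrow> 'b"

definition fsum :: "('i \<Rightarrow> 'b::comm_monoid_add series) \<Rightarrow> 'b series" where
  "fsum F = (\<lambda>m S. Sum_any (\<lambda>i. F i m S))"

definition fmul ::
  "(complex \<Rightarrow> 'b \<Rightarrow> 'b::comm_monoid_add) \<Rightarrow> complex series \<Rightarrow> 'b series \<Rightarrow> 'b series" where
  "fmul scale f F = (\<lambda>m S. \<Sum>T\<in>Pow S. Sum_any (\<lambda>k.
      scale (ext_sgn T (S - T) * f k T) (F (m - k) (S - T))))"

abbreviation smul :: "complex series \<Rightarrow> complex series \<Rightarrow> complex series"  (infixl "\<odot>" 70) where
  "f \<odot> g \<equiv> fmul (*) f g"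

definition fscale :: "complex \<Rightarrow> complex series \<Rightarrow> complex series" where
  "fscale c f = (\<lambda>m S. c * f m S)"

definition const :: "'b::zero \<Rightarrow> 'b series" where
  "const b = (\<lambda>m S. if m = (\<lambda>_. 0) \<and> S = {} then b else 0)"

definition xpow :: "evar \<Rightarrow> int \<Rightarrow> complex series" where
  "xpow a p = (\<lambda>m S. if m = (\<lambda>_. 0)(a := p) \<and> S = {} then 1 else 0)"

definition phi :: "ovar \<Rightarrow> complex series" where
  "phi q = (\<lambda>m S. if m = (\<lambda>_. 0) \<and> S = {q} then 1 else 0)"

definition nu :: "complex series" where
  "nu = phi (Phi1 Plus) \<odot> phi (Phi2 Minus) + phi (Phi1 Minus) \<odot> phi (Phi2 Plus)"

text \<open>
  An even argument \<open>A\<close> of a vertex operator or delta function is given by the family of its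
  expanded powers \<open>\<lambda>p. A^p\<close>.  \<open>binpow s a b\<close> is \<open>a + s b\<close>, expanded in nonnegative powers of \<open>b\<close>;
  \<open>taylor A \<zeta>\<close> is \<open>A + \<zeta>\<close> for nilpotent \<open>\<zeta>\<close>, Taylor expanded about \<open>A\<close>, the \<open>j\<close>-th derivative of
  the \<open>p\<close>-th power divided by \<open>j!\<close> being \<open>p gchoose j\<close> times the \<open>(p - j)\<close>-th power.
\<close>

definition binpow :: "complex \<Rightarrow> evar \<Rightarrow> evar \<Rightarrow> int \<Rightarrow> complex series" where
  "binpow s a b p = fsum (\<lambda>i::nat.
     fscale ((of_int p gchoose i) * s ^ i) (xpow a (p - int i) \<odot> xpow b (int i)))"

definition taylor :: "(int \<Rightarrow> complex series) \<Rightarrow> complex series \<Rightarrow> int \<Rightarrow> complex series" where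
  "taylor A \<zeta> p = fsum (\<lambda>j::nat.
     fscale (of_int p gchoose j) (A (p - int j) \<odot> ((\<lambda>f. \<zeta> \<odot> f) ^^ j) (const 1)))"

definition neg_pow :: "(int \<Rightarrow> complex series) \<Rightarrow> int \<Rightarrow> complex series" where
  "neg_pow A p = fscale ((-1) powi p) (A p)"

text \<open>\<open>delta_quot A B\<close> is \<open>\<delta>(A/B)\<close>.\<close>

definition delta_quot :: "(int \<Rightarrow> complex series) \<Rightarrow> (int \<Rightarrow> complex series) \<Rightarrow> complex series" where
  "delta_quot A B = fsum (\<lambda>n. A n \<odot> B (- n))"


section \<open>Vertex operators\<close>

text \<open>
  The modes of \<open>v\<close> are \<open>v\<^sub>n = Y v {} n\<close>, \<open>v\<^sup>+\<^sub>n\<^sub>-\<^sub>1\<^sub>/\<^sub>2 = Y v {Plus} n\<close>, \<open>v\<^sup>-\<^sub>n\<^sub>-\<^sub>1\<^sub>/\<^sub>2 = Y v {Minus} n\<close> and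
  \<open>v\<^sup>+\<^sup>-\<^sub>n\<^sub>-\<^sub>1 = Y v {Plus, Minus} n\<close>, so that \<open>Y v P n\<close> is the coefficient of \<open>\<phi>\<^sup>P x^(-n-1)\<close>.
\<close>

type_synonym 'v vertex_map = "'v \<Rightarrow> pm set \<Rightarrow> int \<Rightarrow> 'v \<Rightarrow> 'v"

definition odd_mon :: "(pm \<Rightarrow> complex series) \<Rightarrow> pm set \<Rightarrow> complex series" where
  "odd_mon \<theta> P = (if Plus \<in> P then \<theta> Plus else const 1) \<odot> (if Minus \<in> P then \<theta> Minus else const 1)"

text \<open>
  An even endomorphism commutes and an odd one anticommutes with the odd variables.  For arbitrary
  \<open>f\<close>, moving an odd variable from the right of \<open>f\<close> to the left replaces \<open>f\<close> by its conjugate under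
  the grading involution, which is \<open>f\<close> for even and \<open>- f\<close> for odd \<open>f\<close>.
\<close>

definition apply_endo ::
  "(bit \<Rightarrow> 'v::ab_group_add set) \<Rightarrow> ('v \<Rightarrow> 'v) \<Rightarrow> 'v series \<Rightarrow> 'v series" where
  "apply_endo V f F = (\<lambda>m S.
     if even (card S) then f (F m S) else grade_inv V (f (grade_inv V (F m S))))"

text \<open>\<open>vop act V Y u A \<theta> F\<close> is \<open>Y(u, (A, \<theta>\<^sup>+, \<theta>\<^sup>-)) F\<close>.\<close>

definition vop ::
  "(grassmann \<Rightarrow> 'v \<Rightarrow> 'v) \<Rightarrow> (bit \<Rightarrow> 'v set) \<Rightarrow> 'v::ab_group_add vertex_map \<Rightarrow>
   'v \<Rightarrow> (int \<Rightarrow> complex series) \<Rightarrow> (pm \<Rightarrow> complex series) \<Rightarrow> 'v series \<Rightarrow> 'v series" where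
  "vop act V Y u A \<theta> F = fsum (\<lambda>n. \<Sum>P\<in>UNIV.
     fmul (cscale act) (odd_mon \<theta> P \<odot> A (- n - 1)) (apply_endo V (Y u P n) F))"

text \<open>
  \<open>vop_series act V Y G A \<theta> F\<close> is \<open>Y(G, (A, \<theta>\<^sup>+, \<theta>\<^sup>-)) F\<close> for a series \<open>G\<close>, with
  \<open>Y(x^k \<phi>\<^sub>T z, \<dots>) = x^k \<phi>\<^sub>T Y(z, \<dots>)\<close>.
\<close>

definition vop_series ::
  "(grassmann \<Rightarrow> 'v \<Rightarrow> 'v) \<Rightarrow> (bit \<Rightarrow> 'v set) \<Rightarrow> 'v::ab_group_add vertex_map \<Rightarrow>
   'v series \<Rightarrow> (int \<Rightarrow> complex series) \<Rightarrow> (pm \<Rightarrow> complex series) \<Rightarrow> 'v series \<Rightarrow> 'v series" where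
  "vop_series act V Y G A \<theta> F = (\<lambda>m S. \<Sum>T\<in>Pow S. Sum_any (\<lambda>k.
     cscale act (ext_sgn T (S - T)) (vop act V Y (G k T) A \<theta> F (m - k) (S - T))))"

definition phi1 :: "pm \<Rightarrow> complex series" where "phi1 s = phi (Phi1 s)"
definition phi2 :: "pm \<Rightarrow> complex series" where "phi2 s = phi (Phi2 s)"


section \<open>Vertex superalgebras\<close>

text \<open>
  In \<open>Y_act\<close> the sign comes from moving \<open>a\<close> to the right of \<open>\<phi>\<^sup>P\<close> in
  \<open>Y(a v, (x, \<phi>\<^sup>+, \<phi>\<^sup>-)) = a Y(v, (x, \<phi>\<^sup>+, \<phi>\<^sup>-))\<close>.
\<close>

locale N2_vertex_data = graded_module L act V
  for L :: enat
    and act :: "grassmann \<Rightarrow> 'v::ab_group_add \<Rightarrow> 'v"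
    and V :: "bit \<Rightarrow> 'v set" +
  fixes Y :: "'v vertex_map"
  assumes Y_add: "Y (u + v) P n z = Y u P n z + Y v P n z"
    and Y_act: "a \<in> Grass_part L i \<Longrightarrow>
          Y (act a v) P n z = koszul (i * of_nat (card P)) (act a (Y v P n z))"
    and Y_sign: "v \<in> V j \<Longrightarrow> Y v P n \<in> End_part L act V (j + of_nat (card P))"

definition truncation :: "'v::zero vertex_map \<Rightarrow> bool" where
  "truncation Y \<longleftrightarrow> (\<forall>u v. \<exists>N. \<forall>n\<ge>N. \<forall>P. Y u P n v = 0)"

definition vacuum_property :: "'v::zero vertex_map \<Rightarrow> 'v \<Rightarrow> bool" where
  "vacuum_property Y vac \<longleftrightarrow> (\<forall>P n z. Y vac P n z = (if P = {} \<and> n = -1 then z else 0))"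

definition creation_property :: "'v::zero vertex_map \<Rightarrow> 'v \<Rightarrow> bool" where
  "creation_property Y vac \<longleftrightarrow>
     (\<forall>v. (\<forall>P. \<forall>n\<ge>0. Y v P n vac = 0) \<and> Y v {} (-1) vac = v)"

text \<open>
  The identity between series of endomorphisms is stated by applying both sides to an arbitrary
  vector \<open>w\<close>; the coefficients of the individual products exist only in this pointwise sense.
\<close>

definition jacobi_identity ::
  "(grassmann \<Rightarrow> 'v \<Rightarrow> 'v) \<Rightarrow> (bit \<Rightarrow> 'v set) \<Rightarrow> 'v::ab_group_add vertex_map \<Rightarrow> bool" where
  "jacobi_identity act V Y \<longleftrightarrow> (\<forall>i j. \<forall>u\<in>V i. \<forall>v\<in>V j. \<forall>w.
     fmul (cscale act)
       (xpow X0 (-1) \<odot> delta_quot (taylor (binpow (-1) X1 X2) (- nu)) (xpow X0))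
       (vop act V Y u (xpow X1) phi1 (vop act V Y v (xpow X2) phi2 (const w)))
     - koszul (i * j)
        (fmul (cscale act)
          (xpow X0 (-1) \<odot> delta_quot (taylor (binpow (-1) X2 X1) nu) (neg_pow (xpow X0)))
          (vop act V Y v (xpow X2) phi2 (vop act V Y u (xpow X1) phi1 (const w))))
     = fmul (cscale act)
        (xpow X2 (-1) \<odot> delta_quot (taylor (binpow (-1) X1 X0) (- nu)) (xpow X2))
        (vop_series act V Y
          (vop act V Y u (xpow X0) (\<lambda>s. phi1 s - phi2 s) (const v))
          (xpow X2) phi2 (const w)))"

locale N2_vertex_superalgebra = N2_vertex_data L act V Y
  for L :: enat
    and act :: "grassmann \<Rightarrow> 'v::ab_group_add \<Rightarrow> 'v"
    and V :: "bit \<Rightarrow> 'v set"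
    and Y :: "'v vertex_map" +
  fixes vac :: 'v
  assumes truncation: "truncation Y"
    and vacuum: "vacuum_property Y vac"
    and creation: "creation_property Y vac"
    and jacobi: "jacobi_identity act V Y"

definition weak_associativity ::
  "(grassmann \<Rightarrow> 'v \<Rightarrow> 'v) \<Rightarrow> (bit \<Rightarrow> 'v set) \<Rightarrow> 'v::ab_group_add vertex_map \<Rightarrow> bool" where
  "weak_associativity act V Y \<longleftrightarrow> (\<forall>u w. \<exists>k::nat. k > 0 \<and> (\<forall>v.
     fmul (cscale act) (taylor (binpow 1 X0 X2) nu (int k))
       (vop_series act V Y
         (vop act V Y u (xpow X0) (\<lambda>s. phi1 s - phi2 s) (const v))
         (xpow X2) phi2 (const w))
     = fmul (cscale act) (taylor (binpow 1 X0 X2) nu (int k))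
        (vop act V Y u (taylor (binpow 1 X0 X2) nu) phi1
          (vop act V Y v (xpow X2) phi2 (const w)))))"

end

theory Submission
  imports Defs "HOL-Computational_Algebra.Formal_Power_Series"
begin

text \<open>
  Choose \<open>K\<close> such that \<open>x\<^sub>1^K Y(u, (x\<^sub>1, \<phi>\<^sub>1\<^sup>+, \<phi>\<^sub>1\<^sup>-)) w\<close> has only nonnegative powers of \<open>x\<^sub>1\<close>, multiply the
  Jacobi identity by \<open>x\<^sub>1^K\<close> and take the residue in \<open>x\<^sub>1\<close>.  The term with the reversed product drops
  out, since its delta function also has only nonnegative powers of \<open>x\<^sub>1\<close>.  In the other two, the
  residue replaces \<open>x\<^sub>1\<close> by \<open>x\<^sub>0 + x\<^sub>2 + \<nu>\<close>, which gives the two sides of weak associativity.  The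
  substitution is carried out on coefficients: the negation rule for binomial coefficients turns
  powers of \<open>x\<^sub>1 - x\<^sub>2 - \<nu>\<close> into powers of \<open>x\<^sub>0 + x\<^sub>2 + \<nu>\<close>, and Vandermonde's identity absorbs the
  factor \<open>(x\<^sub>0 + x\<^sub>2 + \<nu>)^K\<close>.  All sums are finite since \<open>\<nu>\<^sup>3 = 0\<close>.
\<close>

section \<open>Collapsing and reindexing sums\<close>

lemma sum_fun_apply: "(\<Sum>x\<in>A. f x) y = (\<Sum>x\<in>A. f x y)"
  by (induction A rule: infinite_finite_induct) simp_all

text \<open>Each \<open>x\<close> contributes for the single index \<open>n = g x\<close>, so
  exchanging the sums leaves one term per \<open>x\<close>. This evaluates the sum over all modes of
  a vertex operator whose argument is an expanded power.\<close>

lemma Sum_any_sum_graph: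
  fixes h :: "'i \<Rightarrow> 'b::comm_monoid_add"
  assumes "finite A"
  shows "Sum_any (\<lambda>n. \<Sum>x\<in>A. if n = g x then h x else 0) = sum h A"
proof -
  have "Sum_any (\<lambda>n. \<Sum>x\<in>A. if n = g x then h x else 0)
      = (\<Sum>n\<in>g ` A. \<Sum>x\<in>A. if n = g x then h x else 0)"
  proof (rule Sum_any.expand_superset)
    show "{n. (\<Sum>x\<in>A. if n = g x then h x else 0) \<noteq> 0} \<subseteq> g ` A"
      by (auto elim!: sum.not_neutral_contains_not_neutral split: if_splits)
  qed (use assms in simp)
  also have "\<dots> = (\<Sum>x\<in>A. \<Sum>n\<in>g ` A. if n = g x then h x else 0)"
    by (rule sum.swap)
  also have "\<dots> = sum h A"
    using assms by (intro sum.cong) auto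
  finally show ?thesis .
qed

lemma Sum_any_single:
  assumes "\<And>n. n \<noteq> a \<Longrightarrow> f n = 0"
  shows "Sum_any f = f a"
  using Sum_any.expand_superset[of "{a}" f] assms by auto

text \<open>The square and the triangle \<open>i + j \<le> n\<close> differ only by vanishing terms,
  and the triangle is summed along antidiagonals as in a Cauchy product.\<close>

lemma sum_square_diagonals:
  fixes g :: "nat \<Rightarrow> nat \<Rightarrow> 'b::comm_monoid_add"
  assumes "\<And>i j. i + j > n \<Longrightarrow> g i j = 0"
  shows "(\<Sum>i\<le>n. \<Sum>j\<le>n. g i j) = (\<Sum>k\<le>n. \<Sum>i\<le>k. g i (k - i))"
proof -
  have "(\<Sum>i\<le>n. \<Sum>j\<le>n. g i j) = (\<Sum>(i, j)\<in>{..n} \<times> {..n}. g i j)"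
    by (simp add: sum.cartesian_product)
  also have "\<dots> = (\<Sum>(i, j)\<in>{(i, j). i + j \<le> n}. g i j)"
  proof (rule sum.mono_neutral_right)
    show "\<forall>x\<in>{..n} \<times> {..n} - {(i, j). i + j \<le> n}. (case x of (i, j) \<Rightarrow> g i j) = 0"
      by (auto intro!: assms simp: not_le)
  qed auto
  also have "\<dots> = (\<Sum>k\<le>n. \<Sum>i\<le>k. g i (k - i))"
    by (rule sum.triangle_reindex_eq)
  finally show ?thesis .
qed


section \<open>The exterior algebra acting on coefficients\<close>

text \<open>At a fixed exponent of the even variables, a series is a function of the set of odd
  variables. \<open>fmul\<close> is then a convolution over exponents whose pointwise product is
  this action.\<close>

definition ext_act ::
  "(complex \<Rightarrow> 'b \<Rightarrow> 'b::comm_monoid_add) \<Rightarrow> ('g::linorder set \<Rightarrow> complex) \<Rightarrow> ('g set \<Rightarrow> 'b) \<Rightarrow> 'g set \<Rightarrow> 'b"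
  where "ext_act scale e h S = (\<Sum>T\<in>Pow S. scale (ext_sgn T (S - T) * e T) (h (S - T)))"

lemma ext_act_times: "ext_act (*) = ext_mult"
  unfolding ext_act_def ext_mult_def ..

definition ext_scalar :: "complex \<Rightarrow> 'g set \<Rightarrow> complex" where
  "ext_scalar c S = (if S = {} then c else 0)"

text \<open>For disjoint sets, the inversions counted by the two signs together make up
  \<open>S \<times> T\<close>, after swapping the pairs of one of them. This product has even
  cardinality, so the two counts have equal parity.\<close>

lemma ext_sgn_commute:
  assumes "finite S" "finite T" "even (card S)"
  shows "ext_sgn S T = ext_sgn T S"
proof (cases "S \<inter> T = {}")
  case True
  let ?I = "\<lambda>S T. {(s, t). s \<in> S \<and> t \<in> T \<and> t < s}"
  have fin: "finite (?I A B)" if "finite A" "finite B" for A B :: "'a set"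
    by (rule finite_subset[of _ "A \<times> B"]) (use that in auto)
  have "card (?I S T) + card (?I T S) = card (?I S T) + card (prod.swap ` ?I T S)"
    by (simp add: card_image)
  also have "\<dots> = card (?I S T \<union> prod.swap ` ?I T S)"
    by (rule card_Un_disjoint[symmetric]) (use assms fin in auto)
  also have "?I S T \<union> prod.swap ` ?I T S = S \<times> T"
    using True by (auto simp: image_iff neq_iff)
  finally have "even (card (?I S T) + card (?I T S))"
    using assms by (simp add: card_cartesian_product)
  then have "(-1::complex) ^ card (?I S T) = (-1) ^ card (?I T S)"
    by (auto simp: minus_one_power_iff)
  then show ?thesis using True unfolding ext_sgn_def by (simp add: Int_commute)
qed (auto simp: ext_sgn_def Int_commute)

text \<open>Even elements of an exterior algebra are central: passing to complements interchanges
  the factors, and the sign is symmetric wherever \<open>e\<close> is nonzero.\<close>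

lemma ext_mult_commute:
  fixes e f :: "'g::{linorder,finite} set \<Rightarrow> complex"
  assumes "\<And>S. e S \<noteq> 0 \<Longrightarrow> even (card S)"
  shows "ext_mult e f = ext_mult f e"
proof
  fix U :: "'g set"
  have "ext_sgn T (U - T) * e T * f (U - T) = ext_sgn (U - T) T * f (U - T) * e T" for T
    using assms[of T] ext_sgn_commute[of T "U - T"] by (cases "e T = 0") (auto simp: mult_ac)
  then have "ext_mult e f U = (\<Sum>T\<in>Pow U. ext_sgn (U - T) T * f (U - T) * e T)"
    unfolding ext_mult_def by (rule sum.cong[OF refl])
  also have "\<dots> = ext_mult f e U"
    unfolding ext_mult_def
    by (rule sum.reindex_bij_witness[where i = "\<lambda>T. U - T" and j = "\<lambda>T. U - T"])
      (auto simp: double_diff)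
  finally show "ext_mult e f U = ext_mult f e U" .
qed

text \<open>The calculus is set up once for an arbitrary complex vector space, to be used both for
  complex coefficients and for coefficients in the module.\<close>

locale cspace = vector_space scale
  for scale :: "complex \<Rightarrow> 'v::ab_group_add \<Rightarrow> 'v"
begin

abbreviation eact :: "('g::linorder set \<Rightarrow> complex) \<Rightarrow> ('g set \<Rightarrow> 'v) \<Rightarrow> 'g set \<Rightarrow> 'v"  (infixr "\<bullet>" 70)
  where "e \<bullet> h \<equiv> ext_act scale e h"

lemma eact_zero [simp]: "0 \<bullet> h = 0" "e \<bullet> 0 = 0"
  by (auto simp: ext_act_def)

lemma eact_add: "e \<bullet> (h + h') = e \<bullet> h + e \<bullet> h'"
  by (auto simp: ext_act_def scale_right_distrib sum.distrib)

lemma eact_sum: "e \<bullet> (\<Sum>x\<in>A. h x) = (\<Sum>x\<in>A. e \<bullet> h x)"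
  by (rule ext) (simp only: ext_act_def sum_fun_apply scale_sum_right sum.swap[of _ A])

lemma eact_scalar:
  fixes h :: "'g::{linorder,finite} set \<Rightarrow> 'v"
  shows "ext_scalar c \<bullet> h = (\<lambda>S. scale c (h S))"
proof
  fix S
  have "(ext_scalar c \<bullet> h) S = (\<Sum>T\<in>Pow S. if T = {} then scale c (h S) else 0)"
    unfolding ext_act_def by (intro sum.cong) (auto simp: ext_scalar_def)
  then show "(ext_scalar c \<bullet> h) S = scale c (h S)" by simp
qed

lemma eact_scale_left: "(\<lambda>S. c * e S) \<bullet> h = (\<lambda>S. scale c ((e \<bullet> h) S))"
  by (rule ext) (simp add: ext_act_def scale_sum_right mult_ac)

lemma eact_scale_right: "e \<bullet> (\<lambda>S. scale c (h S)) = (\<lambda>S. scale c ((e \<bullet> h) S))"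
  by (rule ext) (simp add: ext_act_def scale_sum_right mult_ac)

text \<open>Both sides sum over the ways to split \<open>U\<close> into three disjoint pieces. The
  signs agree because \<open>ext_sgn\<close> is multiplicative over disjoint unions in either
  argument.\<close>

lemma eact_eact:
  fixes h :: "'g::{linorder,finite} set \<Rightarrow> 'v"
  shows "e \<bullet> f \<bullet> h = ext_mult e f \<bullet> h"
proof
  fix U :: "'g set"
  let ?A = "SIGMA T:Pow U. Pow T" and ?B = "SIGMA R:Pow U. Pow (U - R)"
  let ?F = "\<lambda>(T, R). scale (ext_sgn T (U - T) * (ext_sgn R (T - R) * e R * f (T - R))) (h (U - T))"
  let ?G = "\<lambda>(R, Q). scale (ext_sgn R (U - R) * e R * (ext_sgn Q (U - R - Q) * f Q)) (h (U - R - Q))"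
  have "(ext_mult e f \<bullet> h) U = sum ?F ?A"
    unfolding ext_mult_def ext_act_def
    by (subst sum.Sigma[symmetric]) (auto simp: sum_distrib_left scale_sum_left)
  also have "\<dots> = sum ?G ?B"
  proof (rule sum.reindex_bij_witness[where i = "\<lambda>(R, Q). (R \<union> Q, R)" and j = "\<lambda>(T, R). (R, T - R)"])
    fix a assume "a \<in> ?A"
    then obtain T R where a: "a = (T, R)" "R \<subseteq> T" "T \<subseteq> U" by auto
    have TR: "T = R \<union> (T - R)" and UR: "U - R = (T - R) \<union> (U - T)" and W: "U - R - (T - R) = U - T"
      using a by auto
    have 1: "ext_sgn T (U - T) = ext_sgn R (U - T) * ext_sgn (T - R) (U - T)"
      by (subst TR, rule ext_sgn_Un_left) auto
    have 2: "ext_sgn R (U - R) = ext_sgn R (T - R) * ext_sgn R (U - T)"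
      by (subst UR, rule ext_sgn_Un_right) auto
    show "?G (case a of (T, R) \<Rightarrow> (R, T - R)) = ?F a"
      unfolding a(1) prod.case W 1 2 by (simp add: mult_ac)
  qed auto
  also have "\<dots> = (e \<bullet> f \<bullet> h) U"
    unfolding ext_act_def
    by (subst sum.Sigma[symmetric]) (auto simp: scale_sum_right)
  finally show "(e \<bullet> f \<bullet> h) U = (ext_mult e f \<bullet> h) U" by simp
qed

text \<open>The map \<open>\<kappa>\<close> parametrises a finite set of exponents outside which one
  of the two factors vanishes. Every coefficient of a product below is extracted through such a
  parametrisation.\<close>

lemma fmul_sum:
  assumes A: "finite A" "inj_on \<kappa> A"
    and zero: "\<And>k. k \<notin> \<kappa> ` A \<Longrightarrow> f k = 0 \<or> F (m - k) = 0"
  shows "fmul scale f F m = (\<Sum>x\<in>A. f (\<kappa> x) \<bullet> F (m - \<kappa> x))"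
proof
  fix S
  have "Sum_any (\<lambda>k. scale (ext_sgn T (S - T) * f k T) (F (m - k) (S - T)))
      = (\<Sum>x\<in>A. scale (ext_sgn T (S - T) * f (\<kappa> x) T) (F (m - \<kappa> x) (S - T)))" for T
  proof -
    have "Sum_any (\<lambda>k. scale (ext_sgn T (S - T) * f k T) (F (m - k) (S - T)))
      = (\<Sum>k\<in>\<kappa> ` A. scale (ext_sgn T (S - T) * f k T) (F (m - k) (S - T)))"
      by (rule Sum_any.expand_superset) (use A zero in fastforce)+
    then show ?thesis by (simp add: sum.reindex A)
  qed
  then show "fmul scale f F m S = (\<Sum>x\<in>A. f (\<kappa> x) \<bullet> F (m - \<kappa> x)) S"
    unfolding fmul_def sum_fun_apply ext_act_def by (simp add: sum.swap[of _ A])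
qed

lemma fmul_single:
  assumes "\<And>k. k \<noteq> k0 \<Longrightarrow> f k = 0 \<or> F (m - k) = 0"
  shows "fmul scale f F m = f k0 \<bullet> F (m - k0)"
proof -
  have "fmul scale f F m = (\<Sum>x\<in>{()}. f k0 \<bullet> F (m - k0))"
    by (rule fmul_sum) (use assms in auto)
  then show ?thesis by (simp only: sum.insert finite.emptyI sum.empty) simp
qed


end

interpretation complex_cspace: cspace "(*)"
  by unfold_locales (simp_all only: distrib_left distrib_right mult.assoc mult_1_left)


section \<open>Trinomial coefficients\<close>

text \<open>The coefficient of \<open>A^(p-i-j) B^i N^j\<close> in the power
  \<open>(A + B + N)^p\<close> expanded in nonnegative powers of \<open>B\<close> and
  \<open>N\<close>: first the Taylor expansion in \<open>N\<close>, then the binomial expansion in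
  \<open>B\<close>.\<close>

definition trinom :: "int \<Rightarrow> nat \<Rightarrow> nat \<Rightarrow> complex" where
  "trinom p i j = (of_int p gchoose j) * (of_int (p - int j) gchoose i)"

lemma trinom_eq: "trinom p i j = (of_int p gchoose (i + j)) * of_nat ((i + j) choose j)"
  using gbinomial_trinomial_revision[of j "i + j" "of_int p :: complex"]
  by (simp add: trinom_def binomial_gbinomial)

lemma trinom_commute: "trinom p i j = trinom p j i"
  using binomial_symmetric[of j "i + j"] by (simp add: trinom_eq add.commute)

text \<open>Negating the upper index of both binomial coefficients gives a trinomial coefficient
  with \<open>i\<close> and \<open>j\<close> in the opposite order, which symmetry restores. This
  converts powers of \<open>x1 - x2 - nu\<close> into powers of \<open>x0 + x2 + nu\<close>.\<close>

lemma trinom_negate: "(-1) ^ (i + j) * trinom (- a - 1) i j = trinom (a + int i + int j) i j"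
proof -
  have "(of_int (- a - 1) gchoose j) = (-1) ^ j * (of_int (a + int j) gchoose j :: complex)"
    by (subst gbinomial_negated_upper) simp
  moreover have "(of_int (- a - 1 - int j) gchoose i) = (-1) ^ i * (of_int (a + int i + int j) gchoose i :: complex)"
    by (subst gbinomial_negated_upper) (simp add: add_ac)
  moreover have "trinom (a + int i + int j) i j
      = (of_int (a + int i + int j) gchoose i) * (of_int (a + int j) gchoose j)"
    by (subst trinom_commute) (simp add: trinom_def)
  moreover have "(-1) ^ (i + j) * (((-1) ^ j * x) * ((-1) ^ i * y)) = (y * x :: complex)" for x y
    by (cases "even i"; cases "even j") simp_all
  ultimately show ?thesis by (simp only: trinom_def)
qed

text \<open>Vandermonde's identity is applied twice. In the sum over \<open>i'\<close> the upper
  indices add up to \<open>p + q - j\<close>, independently of \<open>j'\<close>, so the result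
  factors out of the sum over \<open>j'\<close>.\<close>

lemma trinom_Vandermonde:
  "(\<Sum>i'\<le>i. \<Sum>j'\<le>j. trinom p i' j' * trinom q (i - i') (j - j')) = trinom (p + q) i j"
proof -
  have "(\<Sum>i'\<le>i. \<Sum>j'\<le>j. trinom p i' j' * trinom q (i - i') (j - j'))
      = (\<Sum>j'\<le>j. (of_int p gchoose j') * (of_int q gchoose (j - j')) *
          (\<Sum>i'\<le>i. (of_int (p - int j') gchoose i') * (of_int (q - int (j - j')) gchoose (i - i'))))"
    unfolding trinom_def sum_distrib_left by (subst sum.swap) (intro sum.cong refl, simp only: mult_ac)
  also have "\<dots> = (\<Sum>j'\<le>j. (of_int p gchoose j') * (of_int q gchoose (j - j')) *
          (of_int (p + q - int j) gchoose i))"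
  proof (intro sum.cong refl)
    fix j' assume "j' \<in> {..j}"
    then have "(of_int (p - int j') + of_int (q - int (j - j')) :: complex) = of_int (p + q - int j)"
      by simp
    then show "(of_int p gchoose j') * (of_int q gchoose (j - j')) *
          (\<Sum>i'\<le>i. (of_int (p - int j') gchoose i') * (of_int (q - int (j - j')) gchoose (i - i')))
        = (of_int p gchoose j') * (of_int q gchoose (j - j')) * (of_int (p + q - int j) gchoose i :: complex)"
      by (simp only: gbinomial_Vandermonde atMost_atLeast0)
  qed
  also have "\<dots> = trinom (p + q) i j"
    by (simp add: trinom_def gbinomial_Vandermonde atMost_atLeast0 flip: sum_distrib_right)
  finally show ?thesis .
qed

lemma trinom_of_nat_eq_0: "i + j > n \<Longrightarrow> trinom (int n) i j = 0"
  by (simp add: trinom_eq binomial_gbinomial[symmetric])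

text \<open>For a natural exponent this is the multinomial coefficient of \<open>i\<close>,
  \<open>j\<close> and \<open>n - i - j\<close>, which is symmetric in the three parts.\<close>

lemma trinom_of_nat_reflect:
  assumes "i + j \<le> n"
  shows "trinom (int n) (n - (i + j)) j = trinom (int n) i j"
proof -
  have *: "of_int (int n - int j) = (of_nat (n - j) :: complex)"
    using assms by simp
  have "(n - j) choose (n - (i + j)) = (n - j) choose i"
    using assms binomial_symmetric[of i "n - j"] by (simp add: add.commute)
  then show ?thesis
    unfolding trinom_def * binomial_gbinomial[symmetric] by simp
qed


section \<open>Coefficients of the expanded powers and delta functions\<close>

definition ext_pow :: "('g::linorder set \<Rightarrow> complex) \<Rightarrow> nat \<Rightarrow> 'g set \<Rightarrow> complex" where
  "ext_pow e j = (ext_mult e ^^ j) (ext_scalar 1)"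

lemma ext_mult_scalar:
  fixes e :: "'g::{linorder,finite} set \<Rightarrow> complex"
  shows "ext_mult (ext_scalar c) e = (\<lambda>S. c * e S)" "ext_mult e (ext_scalar c) = (\<lambda>S. c * e S)"
proof -
  show "ext_mult (ext_scalar c) e = (\<lambda>S. c * e S)"
    using complex_cspace.eact_scalar[of c e] by (simp add: ext_act_times)
  then show "ext_mult e (ext_scalar c) = (\<lambda>S. c * e S)"
    by (subst ext_mult_commute[symmetric]) (auto simp: ext_scalar_def split: if_splits)
qed

lemma ext_pow_minus:
  fixes e :: "'g::{linorder,finite} set \<Rightarrow> complex"
  shows "ext_pow (- e) j = (\<lambda>S. (-1) ^ j * ext_pow e j S)"
proof (induction j)
  case (Suc j)
  have "ext_pow (- e) (Suc j) = ext_mult (\<lambda>S. (-1) * e S) (\<lambda>S. (-1) ^ j * ext_pow e j S)"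
    using Suc by (simp add: ext_pow_def fun_Compl_def)
  also have "\<dots> = (\<lambda>S. (-1) ^ Suc j * ext_pow e (Suc j) S)"
    using complex_cspace.eact_scale_left[of "-1" e] complex_cspace.eact_scale_right[of e "(-1) ^ j"]
    by (simp add: ext_act_times ext_pow_def)
  finally show ?case .
qed (simp add: ext_pow_def)

text \<open>Degrees add under exterior multiplication, so the \<open>j\<close>-th power of an
  element of degree two is homogeneous of degree \<open>2 * j\<close>.\<close>

lemma ext_pow_card:
  assumes "\<And>S. e S \<noteq> 0 \<Longrightarrow> card S = 2" "ext_pow e j S \<noteq> 0" "finite S"
  shows "card S = 2 * j"
  using assms(2,3)
proof (induction j arbitrary: S)
  case 0
  then show ?case by (auto simp: ext_pow_def ext_scalar_def split: if_splits)
next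
  case (Suc j)
  have "(\<Sum>T\<in>Pow S. ext_sgn T (S - T) * e T * ext_pow e j (S - T)) \<noteq> 0"
    using Suc.prems by (simp add: ext_pow_def ext_mult_def)
  then obtain T where T: "T \<subseteq> S" "e T \<noteq> 0" "ext_pow e j (S - T) \<noteq> 0"
    by (auto elim!: sum.not_neutral_contains_not_neutral)
  then have "card (S - T) = 2 * j" "card T = 2"
    using Suc assms(1) by auto
  moreover have "card S = card T + card (S - T)"
    using T Suc.prems by (metis card_Diff_subset card_mono finite_subset le_add_diff_inverse)
  ultimately show ?case by simp
qed

text \<open>Series in the odd variables alone.\<close>

definition flat :: "complex series \<Rightarrow> bool" where
  "flat f \<longleftrightarrow> (\<forall>m. m \<noteq> 0 \<longrightarrow> f m = 0)"

context cspace
begin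

lemma fmul_flat_left: "flat f \<Longrightarrow> fmul scale f F m = f 0 \<bullet> F m"
  using fmul_single[of 0 f F m] by (simp add: flat_def)

end

lemma fmul_flat_right: "flat g \<Longrightarrow> (f \<odot> g) m = ext_mult (f m) (g 0)"
  using complex_cspace.fmul_single[of m f g m] by (simp add: flat_def ext_act_times)

lemma flat_phi: "flat (phi q)"
  by (auto simp: flat_def phi_def zero_fun_def)

lemma flat_const: "flat (const b)"
  by (auto simp: flat_def const_def zero_fun_def)

lemma flat_fmul: "flat f \<Longrightarrow> flat g \<Longrightarrow> flat (f \<odot> g)"
  using complex_cspace.eact_zero(2)
  by (simp add: flat_def complex_cspace.fmul_flat_left[unfolded flat_def])

lemma flat_add: "flat f \<Longrightarrow> flat g \<Longrightarrow> flat (f + g)"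
  by (simp add: flat_def)

lemma flat_diff: "flat f \<Longrightarrow> flat g \<Longrightarrow> flat (f - g)"
  by (simp add: flat_def)

lemma flat_minus: "flat f \<Longrightarrow> flat (- f)"
  by (simp add: flat_def)

lemma flat_nu: "flat nu"
  by (simp add: nu_def flat_add flat_fmul flat_phi)

lemma flat_odd_mon: "(\<And>s. flat (\<theta> s)) \<Longrightarrow> flat (odd_mon \<theta> P)"
  by (simp add: odd_mon_def flat_fmul flat_const)

lemma nu_card: "nu 0 S \<noteq> 0 \<Longrightarrow> card S = 2"
proof -
  assume "nu 0 S \<noteq> 0"
  moreover have "nu 0 = ext_mult (phi (Phi1 Plus) 0) (phi (Phi2 Minus) 0)
      + ext_mult (phi (Phi1 Minus) 0) (phi (Phi2 Plus) 0)"
    by (simp add: nu_def fmul_flat_right flat_phi)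
  ultimately obtain p q where "ext_mult (phi (Phi1 p) 0) (phi (Phi2 q) 0) S \<noteq> 0"
    by fastforce
  then obtain T where "T \<subseteq> S" "phi (Phi1 p) 0 T \<noteq> 0" "phi (Phi2 q) 0 (S - T) \<noteq> 0"
    by (auto simp: ext_mult_def elim!: sum.not_neutral_contains_not_neutral)
  then have "S = {Phi1 p, Phi2 q}"
    by (auto simp: phi_def split: if_splits)
  then show "card S = 2" by simp
qed

lemma xpow_eq: "xpow a p m = (if m = (\<lambda>_. 0)(a := p) then ext_scalar 1 else 0)"
  by (auto simp: xpow_def ext_scalar_def)

lemma const_eq: "const b m = (if m = 0 then (\<lambda>S. if S = {} then b else 0) else 0)"
  by (auto simp: const_def zero_fun_def)

text \<open>The exponent of \<open>b\<close> determines the summation index, so at most the summand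
  \<open>i = m b\<close> survives.\<close>

lemma binpow_eq:
  assumes "a \<noteq> b"
  shows "binpow s a b p m = ext_scalar
    (if m b \<ge> 0 \<and> m = (\<lambda>_. 0)(a := p - m b, b := m b)
     then (of_int p gchoose nat (m b)) * s ^ nat (m b) else 0)"
proof
  fix S
  have mono: "(xpow a q \<odot> xpow b r) m = (if m = (\<lambda>_. 0)(a := q, b := r) then ext_scalar 1 else 0)" for q r
  proof -
    have "(xpow a q \<odot> xpow b r) m = ext_mult (ext_scalar 1) (xpow b r (m - (\<lambda>_. 0)(a := q)))"
      by (subst complex_cspace.fmul_single[of "(\<lambda>_. 0)(a := q)"]) (auto simp: xpow_eq ext_act_times)
    moreover have "m - (\<lambda>_. 0)(a := q) = (\<lambda>_. 0)(b := r) \<longleftrightarrow> m = (\<lambda>_. 0)(a := q, b := r)"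
      using assms by (auto simp: fun_eq_iff)
    ultimately show ?thesis by (simp add: ext_mult_scalar xpow_eq)
  qed
  have "binpow s a b p m S = Sum_any (\<lambda>i::nat. if m = (\<lambda>_. 0)(a := p - int i, b := int i)
      then ((of_int p gchoose i) * s ^ i) * ext_scalar 1 S else 0)"
    unfolding binpow_def fsum_def fscale_def mono
    by (intro arg_cong[where f = Sum_any] ext) (simp only: zero_fun_apply mult_zero_right split: if_split, simp)
  also have "\<dots> = (if m = (\<lambda>_. 0)(a := p - int (nat (m b)), b := int (nat (m b)))
      then ((of_int p gchoose nat (m b)) * s ^ nat (m b)) * ext_scalar 1 S else 0)"
    by (rule Sum_any_single) auto
  also have "\<dots> = ext_scalar (if m b \<ge> 0 \<and> m = (\<lambda>_. 0)(a := p - m b, b := m b)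
     then (of_int p gchoose nat (m b)) * s ^ nat (m b) else 0) S"
  proof (cases "m b \<ge> 0")
    case False
    then have "m \<noteq> (\<lambda>_. 0)(a := p - int (nat (m b)), b := int (nat (m b)))"
      by (metis fun_upd_same of_nat_0_le_iff)
    with False show ?thesis by (simp add: ext_scalar_def)
  qed (simp add: ext_scalar_def)
  finally show "binpow s a b p m S = \<dots>" .
qed

text \<open>Since \<open>\<zeta>\<close> has degree zero in the even variables, the exponent of
  \<open>b\<close> determines the binomial index and the total degree
  \<open>m a + m b = p - j\<close> determines the Taylor index. At most one term of the double
  expansion is left.\<close>

lemma taylor_binpow:
  assumes "a \<noteq> b" "flat \<zeta>"
  shows "taylor (binpow s a b) \<zeta> p m =
    (if m b \<ge> 0 \<and> m a + m b \<le> p \<and> (\<forall>c. c \<noteq> a \<longrightarrow> c \<noteq> b \<longrightarrow> m c = 0)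
     then (\<lambda>S. trinom p (nat (m b)) (nat (p - m a - m b)) * s ^ nat (m b)
                 * ext_pow (\<zeta> 0) (nat (p - m a - m b)) S)
     else 0)"
    (is "_ = (if ?ok then ?r else 0)")
proof
  fix S
  let ?pw = "\<lambda>j. ((\<lambda>f. \<zeta> \<odot> f) ^^ j) (const 1)"
  have flat_pw: "flat (?pw j)" for j
    by (induction j) (simp_all add: flat_const flat_fmul assms)
  have pw: "?pw j 0 = ext_pow (\<zeta> 0) j" for j
  proof (induction j)
    case 0
    then show ?case by (auto simp: const_eq ext_pow_def ext_scalar_def)
  next
    case (Suc j)
    then show ?case
      by (simp only: ext_pow_def funpow.simps o_apply fmul_flat_right[OF flat_pw])
  qed
  have "taylor (binpow s a b) \<zeta> p m S
      = Sum_any (\<lambda>j. (of_int p gchoose j) * ext_mult (binpow s a b (p - int j) m) (ext_pow (\<zeta> 0) j) S)"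
    unfolding taylor_def fsum_def fscale_def by (simp only: fmul_flat_right[OF flat_pw] pw)
  also have "\<dots> = Sum_any (\<lambda>j. if m b \<ge> 0 \<and> m = (\<lambda>_. 0)(a := p - int j - m b, b := m b)
      then trinom p (nat (m b)) j * s ^ nat (m b) * ext_pow (\<zeta> 0) j S else 0)"
    unfolding binpow_eq[OF assms(1)] ext_mult_scalar trinom_def
    by (intro arg_cong[where f = Sum_any] ext) (simp only: mult_zero_left mult_zero_right mult_ac split: if_split, simp, blast)
  also have "\<dots> = (if m b \<ge> 0 \<and> m = (\<lambda>_. 0)(a := p - int (nat (p - m a - m b)) - m b, b := m b)
      then trinom p (nat (m b)) (nat (p - m a - m b)) * s ^ nat (m b)
             * ext_pow (\<zeta> 0) (nat (p - m a - m b)) S else 0)"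
  proof (rule Sum_any_single)
    fix j assume j: "j \<noteq> nat (p - m a - m b)"
    have "m \<noteq> (\<lambda>_. 0)(a := p - int j - m b, b := m b)"
    proof
      assume "m = (\<lambda>_. 0)(a := p - int j - m b, b := m b)"
      then have "m a = p - int j - m b"
        using assms(1) by (metis fun_upd_other fun_upd_same)
      then show False using j by simp
    qed
    then show "(if m b \<ge> 0 \<and> m = (\<lambda>_. 0)(a := p - int j - m b, b := m b)
      then trinom p (nat (m b)) j * s ^ nat (m b) * ext_pow (\<zeta> 0) j S else 0) = 0"
      by simp
  qed
  also have "m = (\<lambda>_. 0)(a := p - int (nat (p - m a - m b)) - m b, b := m b)
      \<longleftrightarrow> m a + m b \<le> p \<and> (\<forall>c. c \<noteq> a \<longrightarrow> c \<noteq> b \<longrightarrow> m c = 0)"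
    using assms(1) by (auto simp: fun_eq_iff)
  finally show "taylor (binpow s a b) \<zeta> p m S = (if ?ok then ?r else 0) S"
    by auto
qed

text \<open>\<open>T\<close> does not involve \<open>c\<close>, so the exponent of \<open>c\<close>
  singles out one power of \<open>T\<close>; the shift by one comes from the prefactor
  \<open>c^(-1)\<close>. The scalar \<open>g p\<close> accommodates the sign in powers of
  \<open>- c\<close>.\<close>

lemma delta_quot_eq:
  assumes T: "\<And>n k. k c \<noteq> 0 \<Longrightarrow> T n k = 0"
    and B: "\<And>p k. B p k = (if k = (\<lambda>_. 0)(c := p) then ext_scalar (g p) else 0)"
  shows "(xpow c (-1) \<odot> delta_quot T B) m = (\<lambda>S. g (m c + 1) * T (- m c - 1) (m(c := 0)) S)"
proof -
  have summand: "(T n \<odot> B (- n)) m = (\<lambda>S. g (- n) * T n (m - (\<lambda>_. 0)(c := - n)) S)" for n m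
  proof -
    have "m - k = (\<lambda>_. 0)(c := - n) \<longleftrightarrow> k = m - (\<lambda>_. 0)(c := - n)" for k :: "evar \<Rightarrow> int"
      by (auto simp: fun_eq_iff algebra_simps)
    then show ?thesis
      by (subst complex_cspace.fmul_single[of "m - (\<lambda>_. 0)(c := - n)"])
        (simp_all add: B ext_act_times ext_mult_scalar)
  qed
  have quot: "delta_quot T B m = (\<lambda>S. g (m c) * T (- m c) (m(c := 0)) S)" for m
  proof
    fix S
    have "delta_quot T B m S = Sum_any (\<lambda>n. g (- n) * T n (m - (\<lambda>_. 0)(c := - n)) S)"
      by (simp add: delta_quot_def fsum_def summand)
    also have "\<dots> = g (- (- m c)) * T (- m c) (m - (\<lambda>_. 0)(c := - (- m c))) S"
      by (rule Sum_any_single) (simp add: T)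
    also have "m - (\<lambda>_. 0)(c := - (- m c)) = m(c := 0)" by auto
    finally show "delta_quot T B m S = g (m c) * T (- m c) (m(c := 0)) S"
      by (simp only: minus_minus)
  qed
  have "(xpow c (-1) \<odot> delta_quot T B) m
      = ext_mult (ext_scalar 1) (delta_quot T B (m - (\<lambda>_. 0)(c := - 1)))"
    by (subst complex_cspace.fmul_single[of "(\<lambda>_. 0)(c := - 1)"]) (auto simp: xpow_eq ext_act_times)
  moreover have "(m - (\<lambda>_. 0)(c := - 1))(c := 0) = m(c := 0)"
    by auto
  moreover have "(m - (\<lambda>_. 0)(c := - 1)) c = m c + 1"
    by simp
  moreover have "- (m c + 1) = - m c - 1"
    by simp
  ultimately show ?thesis by (simp only: quot ext_mult_scalar mult_1_left)
qed

section \<open>Powers of \<open>nu\<close> and their nilpotency\<close>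

lemma ext_mult_assoc_fun:
  fixes e :: "'g::{linorder,finite} set \<Rightarrow> complex"
  shows "ext_mult (ext_mult e f) h = ext_mult e (ext_mult f h)"
  by (rule ext) (simp only: ext_mult_assoc finite)

lemma ext_pow_add:
  fixes e :: "'g::{linorder,finite} set \<Rightarrow> complex"
  shows "ext_mult (ext_pow e i) (ext_pow e j) = ext_pow e (i + j)"
proof (induction i)
  case 0
  show ?case by (simp add: ext_pow_def ext_mult_scalar)
next
  case (Suc i)
  have "ext_mult (ext_pow e (Suc i)) (ext_pow e j) = ext_mult e (ext_mult (ext_pow e i) (ext_pow e j))"
    by (simp add: ext_pow_def ext_mult_assoc_fun)
  with Suc show ?case by (simp add: ext_pow_def)
qed

lemma nu_pow_card: "ext_pow (nu 0) j S \<noteq> 0 \<Longrightarrow> card S = 2 * j"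
  by (rule ext_pow_card) (auto intro: nu_card)

text \<open>The \<open>j\<close>-th power has degree \<open>2 * j\<close>, and there are only four
  odd variables.\<close>

lemma nu_pow_eq_0:
  assumes "j > 2"
  shows "ext_pow (nu 0) j = 0"
proof
  fix S
  have "ovar_index p \<le> 3" for p
    by (cases p rule: ovar_index.cases) simp_all
  then have "card (ovar_index ` S) \<le> card {..3::nat}"
    by (intro card_mono) auto
  moreover have "card (ovar_index ` S) = card S"
    by (rule card_image) (auto intro: inj_onI ovar_index_inject)
  ultimately have "card S \<noteq> 2 * j" using assms by simp
  then show "ext_pow (nu 0) j S = 0 S"
    using nu_pow_card[of j S] by auto
qed

text \<open>The signs of \<open>- b\<close> and \<open>- nu\<close> combine to
  \<open>(-1)^(i+j)\<close>, which \<open>trinom_negate\<close> absorbs. The exponent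
  \<open>- q - 1\<close> is the one that a delta function selects at the power \<open>q\<close> of
  its denominator.\<close>

lemma taylor_binpow_minus:
  assumes "a \<noteq> b"
  shows "taylor (binpow (-1) a b) (- nu) (- q - 1) m =
    (if m b \<ge> 0 \<and> m a + m b \<le> - q - 1 \<and> (\<forall>c. c \<noteq> a \<longrightarrow> c \<noteq> b \<longrightarrow> m c = 0)
     then (\<lambda>S. trinom (- m a - 1) (nat (m b)) (nat (- q - 1 - m a - m b))
                 * ext_pow (nu 0) (nat (- q - 1 - m a - m b)) S)
     else 0)"
proof (cases "m b \<ge> 0 \<and> m a + m b \<le> - q - 1")
  case True
  define i where "i = nat (m b)"
  define j where "j = nat (- q - 1 - m a - m b)"
  have q: "- m a - 1 = q + int i + int j"
    using True by (simp add: i_def j_def)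
  have "trinom (- q - 1) i j * (-1) ^ i * ext_pow ((- nu) 0) j S
      = ((-1) ^ (i + j) * trinom (- q - 1) i j) * ext_pow (nu 0) j S" for S
    by (simp add: ext_pow_minus power_add)
  also have "\<dots> S = trinom (- m a - 1) i j * ext_pow (nu 0) j S" for S
    by (simp only: trinom_negate q)
  finally show ?thesis
    using True unfolding taylor_binpow[OF assms flat_minus[OF flat_nu]]
    by (simp only: i_def j_def)
next
  case False
  then show ?thesis
    unfolding taylor_binpow[OF assms flat_minus[OF flat_nu]] by auto
qed


section \<open>Extracting coefficients of products with powers and delta functions\<close>

context cspace
begin

text \<open>Multiplication by \<open>c * nu^j\<close>. All odd factors coming from the expanded
  powers and the delta functions have this form, and the form is closed under composition.\<close>

definition nuterm :: "complex \<Rightarrow> nat \<Rightarrow> (ovar set \<Rightarrow> 'v) \<Rightarrow> ovar set \<Rightarrow> 'v" where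
  "nuterm c j h = (\<lambda>S. c * ext_pow (nu 0) j S) \<bullet> h"

lemma nuterm_zero: "nuterm 0 j h = 0" "nuterm c j 0 = 0" "j > 2 \<Longrightarrow> nuterm c j h = 0"
  by (rule ext, simp add: nuterm_def ext_act_def nu_pow_eq_0)+

lemma nuterm_add: "nuterm c j (h + h') = nuterm c j h + nuterm c j h'"
  by (simp only: nuterm_def eact_add)

lemma nuterm_sum_right: "nuterm c j (\<Sum>x\<in>A. h x) = (\<Sum>x\<in>A. nuterm c j (h x))"
  by (simp only: nuterm_def eact_sum)

lemma nuterm_sum_left: "nuterm (\<Sum>x\<in>A. c x) j h = (\<Sum>x\<in>A. nuterm (c x) j h)"
  by (rule ext) (simp only: nuterm_def eact_scale_left sum_fun_apply scale_sum_left)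

lemma nuterm_nuterm: "nuterm c j (nuterm c' j' h) = nuterm (c * c') (j + j') h"
  by (simp only: nuterm_def eact_scale_left eact_scale_right scale_scale eact_eact ext_pow_add)

text \<open>Powers of \<open>nu\<close> are even, hence central; they pass the odd monomials of a
  vertex operator.\<close>

lemma eact_nuterm: "e \<bullet> nuterm c j h = nuterm c j (e \<bullet> h)"
proof -
  have "ext_mult e (ext_pow (nu 0) j) = ext_mult (ext_pow (nu 0) j) e"
    by (rule ext_mult_commute[symmetric]) (simp add: nu_pow_card)
  then show ?thesis
    by (simp only: nuterm_def eact_scale_left eact_scale_right eact_eact)
qed

text \<open>
  Coefficientwise form of \<open>(x\<^sub>0 + x\<^sub>2 + \<nu>)^K (x\<^sub>0 + x\<^sub>2 + \<nu>)^p = (x\<^sub>0 + x\<^sub>2 + \<nu>)^(K + p)\<close>, applied to the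
  coefficients \<open>A p q\<close> of \<open>x\<^sub>1^p x\<^sub>2^q\<close> in a series with \<open>x\<^sub>1\<close> replaced by \<open>x\<^sub>0 + x\<^sub>2 + \<nu>\<close>.
\<close>

lemma nuterm_Vandermonde:
  fixes A :: "int \<Rightarrow> int \<Rightarrow> ovar set \<Rightarrow> 'v"
  assumes A: "\<And>p q. q < b - int I \<Longrightarrow> A p q = 0"
  shows "(\<Sum>i\<le>I. \<Sum>j\<le>2. nuterm (trinom K i j) j
      (\<Sum>i'\<le>I. \<Sum>j'\<le>2. nuterm (trinom (a - (K - int i - int j) + int i' + int j') i' j') j'
        (A (a - (K - int i - int j) + int i' + int j') (b - int i - int i'))))
    = (\<Sum>i\<le>I. \<Sum>j\<le>2. nuterm (trinom (a + int i + int j) i j) j (A (a - K + int i + int j) (b - int i)))"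
proof -
  \<comment> \<open>The exponents and the power of \<open>nu\<close> depend only on
    \<open>i + i'\<close> and \<open>j + j'\<close>. Along a diagonal just the product of trinomial
    coefficients varies, and \<open>trinom_Vandermonde\<close> sums it.\<close>
  define t where "t i i' j j' = (let p = a - K + int (i + i') + int (j + j') in
    nuterm (trinom K i j * trinom p i' j') (j + j') (A p (b - int (i + i'))))" for i i' j j'
  have idx: "a - (K - int i - int j) + int i' + int j' = a - K + int (i + i') + int (j + j')"
    "b - int i - int i' = b - int (i + i')" for i i' j j'
    by simp_all
  \<comment> \<open>Lower truncation of \<open>A\<close> bounds \<open>i + i'\<close> and nilpotency
    of \<open>nu\<close> bounds \<open>j + j'\<close>; this reduces both squares to
    triangles.\<close>
  have zero_i: "t i i' j j' = 0" if "i + i' > I" for i i' j j'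
    using that A by (simp add: t_def Let_def nuterm_zero)
  have zero_j: "t i i' j j' = 0" if "j + j' > 2" for i i' j j'
    using that by (simp add: t_def Let_def nuterm_zero)
  have "(\<Sum>i\<le>I. \<Sum>j\<le>2. nuterm (trinom K i j) j
      (\<Sum>i'\<le>I. \<Sum>j'\<le>2. nuterm (trinom (a - (K - int i - int j) + int i' + int j') i' j') j'
        (A (a - (K - int i - int j) + int i' + int j') (b - int i - int i'))))
    = (\<Sum>i\<le>I. \<Sum>j\<le>2. \<Sum>i'\<le>I. \<Sum>j'\<le>2. t i i' j j')"
    by (simp only: idx nuterm_sum_right nuterm_nuterm t_def Let_def)
  also have "\<dots> = (\<Sum>i\<le>I. \<Sum>i'\<le>I. \<Sum>j\<le>2. \<Sum>j'\<le>2. t i i' j j')"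
    by (rule sum.cong[OF refl], rule sum.swap)
  also have "\<dots> = (\<Sum>k\<le>I. \<Sum>i\<le>k. \<Sum>j\<le>2. \<Sum>j'\<le>2. t i (k - i) j j')"
    by (rule sum_square_diagonals) (intro sum.neutral ballI zero_i)
  also have "\<dots> = (\<Sum>k\<le>I. \<Sum>i\<le>k. \<Sum>l\<le>2. \<Sum>j\<le>l. t i (k - i) j (l - j))"
    by (intro sum.cong refl sum_square_diagonals zero_j)
  also have "\<dots> = (\<Sum>k\<le>I. \<Sum>l\<le>2. \<Sum>i\<le>k. \<Sum>j\<le>l. t i (k - i) j (l - j))"
    by (rule sum.cong[OF refl], rule sum.swap)
  also have "\<dots> = (\<Sum>k\<le>I. \<Sum>l\<le>2. nuterm (trinom (a + int k + int l) k l) l (A (a - K + int k + int l) (b - int k)))"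
  proof (intro sum.cong refl)
    fix k l
    let ?p = "a - K + int k + int l"
    have "(\<Sum>i\<le>k. \<Sum>j\<le>l. t i (k - i) j (l - j))
        = (\<Sum>i\<le>k. \<Sum>j\<le>l. nuterm (trinom K i j * trinom ?p (k - i) (l - j)) l (A ?p (b - int k)))"
      by (intro sum.cong refl) (simp add: t_def Let_def)
    also have "\<dots> = nuterm (trinom (K + ?p) k l) l (A ?p (b - int k))"
      by (simp only: nuterm_sum_left[symmetric] trinom_Vandermonde)
    also have "K + ?p = a + int k + int l" by simp
    finally show "(\<Sum>i\<le>k. \<Sum>j\<le>l. t i (k - i) j (l - j))
        = nuterm (trinom (a + int k + int l) k l) l (A ?p (b - int k))" .
  qed
  finally show ?thesis .
qed

text \<open>The exponents of \<open>(x0 + x2 + nu)^p\<close> are indexed by the powers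
  \<open>i\<close> of \<open>x2\<close> and \<open>j\<close> of \<open>nu\<close>. A pair may be
  left out of \<open>W\<close> because its coefficient vanishes, because \<open>nu^j\<close> does,
  or because \<open>U\<close> is truncated.\<close>

lemma fmul_taylor_plus:
  assumes W: "finite W"
    and zero: "\<And>i j. (i, j) \<notin> W \<Longrightarrow>
      trinom p i j = 0 \<or> j > 2 \<or> U (m - (\<lambda>_. 0)(X0 := p - int i - int j, X2 := int i)) = 0"
  shows "fmul scale (taylor (binpow 1 X0 X2) nu p) U m
    = (\<Sum>(i, j)\<in>W. nuterm (trinom p i j) j (U (m - (\<lambda>_. 0)(X0 := p - int i - int j, X2 := int i))))"
proof -
  let ?\<kappa> = "\<lambda>(i, j). (\<lambda>_. 0)(X0 := p - int i - int j, X2 := int i)"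
  let ?f = "taylor (binpow 1 X0 X2) nu p"
  have f: "?f ((\<lambda>_. 0)(X0 := p - int i - int j, X2 := int i))
      = (\<lambda>S. trinom p i j * ext_pow (nu 0) j S)" for i j
    by (subst taylor_binpow) (simp_all add: flat_nu)
  have "fmul scale ?f U m = (\<Sum>x\<in>W. ?f (?\<kappa> x) \<bullet> U (m - ?\<kappa> x))"
  proof (rule fmul_sum[OF W])
    show "inj_on ?\<kappa> W"
    proof (rule inj_onI)
      fix x y assume eq: "?\<kappa> x = ?\<kappa> y"
      obtain i j i' j' where xy: "x = (i, j)" "y = (i', j')" by (metis surj_pair)
      from fun_cong[OF eq, of X2] fun_cong[OF eq, of X0] xy show "x = y" by simp
    qed
    fix k assume k: "k \<notin> ?\<kappa> ` W"
    show "?f k = 0 \<or> U (m - k) = 0"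
    proof (cases "k X2 \<ge> 0 \<and> k X0 + k X2 \<le> p \<and> (\<forall>c. c \<noteq> X0 \<longrightarrow> c \<noteq> X2 \<longrightarrow> k c = 0)")
      case True
      define i where "i = nat (k X2)"
      define j where "j = nat (p - k X0 - k X2)"
      have k_eq: "k = ?\<kappa> (i, j)"
      proof
        fix c show "k c = ?\<kappa> (i, j) c"
          using True by (cases c) (simp_all add: i_def j_def)
      qed
      with k have "(i, j) \<notin> W" by auto
      then have "trinom p i j = 0 \<or> j > 2 \<or> U (m - k) = 0"
        using zero[of i j] by (simp add: k_eq)
      moreover have "?f k = (\<lambda>S. trinom p i j * ext_pow (nu 0) j S)"
        unfolding k_eq prod.case by (rule f)
      ultimately show ?thesis
        using nu_pow_eq_0[of j] by (auto simp: zero_fun_def)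
    next
      case False
      then have "?f k = 0"
        by (subst taylor_binpow) (auto simp: flat_nu)
      then show ?thesis ..
    qed
  qed
  also have "\<dots> = (\<Sum>(i, j)\<in>W. nuterm (trinom p i j) j (U (m - (\<lambda>_. 0)(X0 := p - int i - int j, X2 := int i))))"
    by (intro sum.cong refl) (simp only: split_beta f nuterm_def prod.case)
  finally show ?thesis .
qed

text \<open>\<open>U\<close> does not involve x0, so the delta function supplies the whole power of
  x0 and thereby fixes the exponent of \<open>x1 - x2 - nu\<close>. The negated coefficients are
  those of powers of \<open>x0 + x2 + nu\<close>.\<close>

lemma delta_product_coeff:
  assumes U: "\<And>k. k X0 \<noteq> 0 \<Longrightarrow> U k = 0"
    and W: "finite W"
    and zero: "\<And>i j. (i, j) \<notin> W \<Longrightarrow>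
      j > 2 \<or> U (m - (\<lambda>_. 0)(X0 := m X0, X1 := - m X0 - 1 - int i - int j, X2 := int i)) = 0"
  shows "fmul scale (xpow X0 (-1) \<odot> delta_quot (taylor (binpow (-1) X1 X2) (- nu)) (xpow X0)) U m
    = (\<Sum>(i, j)\<in>W. nuterm (trinom (m X0 + int i + int j) i j) j
        (U (m - (\<lambda>_. 0)(X0 := m X0, X1 := - m X0 - 1 - int i - int j, X2 := int i))))"
proof -
  let ?\<kappa> = "\<lambda>(i, j). (\<lambda>_. 0)(X0 := m X0, X1 := - m X0 - 1 - int i - int j, X2 := int i)"
  let ?T = "taylor (binpow (-1) X1 X2) (- nu)"
  let ?D = "xpow X0 (-1) \<odot> delta_quot ?T (xpow X0)"
  have D: "?D k = ?T (- k X0 - 1) (k(X0 := 0))" for k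
    by (subst delta_quot_eq[where g = "\<lambda>_. 1"])
      (auto simp: taylor_binpow flat_minus flat_nu xpow_eq)
  have f: "?D ((\<lambda>_. 0)(X0 := m X0, X1 := - m X0 - 1 - int i - int j, X2 := int i))
      = (\<lambda>S. trinom (m X0 + int i + int j) i j * ext_pow (nu 0) j S)" for i j
    unfolding D by (subst taylor_binpow_minus) (simp_all add: add_ac)
  have "fmul scale ?D U m = (\<Sum>x\<in>W. ?D (?\<kappa> x) \<bullet> U (m - ?\<kappa> x))"
  proof (rule fmul_sum[OF W])
    show "inj_on ?\<kappa> W"
    proof (rule inj_onI)
      fix x y assume eq: "?\<kappa> x = ?\<kappa> y"
      obtain i j i' j' where xy: "x = (i, j)" "y = (i', j')" by (metis surj_pair)
      from fun_cong[OF eq, of X2] fun_cong[OF eq, of X1] xy show "x = y" by simp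
    qed
    fix k assume k: "k \<notin> ?\<kappa> ` W"
    show "?D k = 0 \<or> U (m - k) = 0"
    proof (cases "k X0 = m X0 \<and> k X2 \<ge> 0 \<and> k X1 + k X2 \<le> - k X0 - 1")
      case True
      define i where "i = nat (k X2)"
      define j where "j = nat (- k X0 - 1 - k X1 - k X2)"
      have k_eq: "k = ?\<kappa> (i, j)"
      proof
        fix c show "k c = ?\<kappa> (i, j) c"
          using True by (cases c) (simp_all add: i_def j_def)
      qed
      with k have "(i, j) \<notin> W" by auto
      then have "j > 2 \<or> U (m - k) = 0"
        using zero[of i j] by (simp add: k_eq)
      moreover have "?D k = (\<lambda>S. trinom (m X0 + int i + int j) i j * ext_pow (nu 0) j S)"
        unfolding k_eq prod.case by (rule f)
      ultimately show ?thesis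
        using nu_pow_eq_0[of j] by (auto simp: zero_fun_def)
    next
      case False
      have "?D k = 0" if "\<not> (k X2 \<ge> 0 \<and> k X1 + k X2 \<le> - k X0 - 1)"
        unfolding D by (subst taylor_binpow_minus) (use that in auto)
      moreover have "U (m - k) = 0" if "k X0 \<noteq> m X0"
        by (rule U) (use that in simp)
      ultimately show ?thesis using False by blast
    qed
  qed
  also have "\<dots> = (\<Sum>(i, j)\<in>W. nuterm (trinom (m X0 + int i + int j) i j) j
        (U (m - (\<lambda>_. 0)(X0 := m X0, X1 := - m X0 - 1 - int i - int j, X2 := int i))))"
    by (intro sum.cong refl) (simp only: split_beta f nuterm_def prod.case)
  finally show ?thesis .
qed

text \<open>\<open>U\<close> does not involve x1, so the delta function supplies
  \<open>x1^(-K-1)\<close>. Negation then gives the upper index \<open>K\<close>, a natural number,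
  and the sum stops at \<open>i + j = K\<close>.\<close>

lemma delta_iterate_coeff:
  assumes U: "\<And>k. k X1 \<noteq> 0 \<Longrightarrow> U k = 0"
    and m: "m X1 = - int K - 1"
  shows "fmul scale (xpow X2 (-1) \<odot> delta_quot (taylor (binpow (-1) X1 X0) (- nu)) (xpow X2)) U m
    = (\<Sum>(i, j)\<in>{(i, j). i + j \<le> K}. nuterm (trinom (int K) i j) j
        (U (m - (\<lambda>_. 0)(X0 := int i, X1 := - int K - 1, X2 := int K - int i - int j))))"
proof -
  let ?W = "{(i, j). i + j \<le> K}"
  let ?\<kappa> = "\<lambda>(i, j). (\<lambda>_. 0)(X0 := int i, X1 := - int K - 1, X2 := int K - int i - int j)"
  let ?T = "taylor (binpow (-1) X1 X0) (- nu)"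
  let ?D = "xpow X2 (-1) \<odot> delta_quot ?T (xpow X2)"
  have W: "finite ?W"
    by (rule finite_subset[of _ "{..K} \<times> {..K}"]) auto
  have D: "?D k = ?T (- k X2 - 1) (k(X2 := 0))" for k
    by (subst delta_quot_eq[where g = "\<lambda>_. 1"])
      (auto simp: taylor_binpow flat_minus flat_nu xpow_eq)
  have f: "?D ((\<lambda>_. 0)(X0 := int i, X1 := - int K - 1, X2 := int K - int i - int j))
      = (\<lambda>S. trinom (int K) i j * ext_pow (nu 0) j S)" for i j
    unfolding D by (subst taylor_binpow_minus) simp_all
  have "fmul scale ?D U m = (\<Sum>x\<in>?W. ?D (?\<kappa> x) \<bullet> U (m - ?\<kappa> x))"
  proof (rule fmul_sum[OF W])
    show "inj_on ?\<kappa> ?W"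
    proof (rule inj_onI)
      fix x y assume eq: "?\<kappa> x = ?\<kappa> y"
      obtain i j i' j' where xy: "x = (i, j)" "y = (i', j')" by (metis surj_pair)
      from fun_cong[OF eq, of X0] fun_cong[OF eq, of X2] xy show "x = y" by simp
    qed
    fix k assume k: "k \<notin> ?\<kappa> ` ?W"
    show "?D k = 0 \<or> U (m - k) = 0"
    proof (cases "k X1 = m X1 \<and> k X0 \<ge> 0 \<and> k X1 + k X0 \<le> - k X2 - 1")
      case True
      define i where "i = nat (k X0)"
      define j where "j = nat (- k X2 - 1 - k X1 - k X0)"
      have k_eq: "k = ?\<kappa> (i, j)"
      proof
        fix c show "k c = ?\<kappa> (i, j) c"
          using True m by (cases c) (simp_all add: i_def j_def)
      qed
      with k have "\<not> i + j \<le> K" by auto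
      then have "trinom (int K) i j = 0"
        by (simp add: trinom_of_nat_eq_0)
      moreover have "?D k = (\<lambda>S. trinom (int K) i j * ext_pow (nu 0) j S)"
        unfolding k_eq prod.case by (rule f)
      ultimately show ?thesis by (auto simp: zero_fun_def)
    next
      case False
      have "?D k = 0" if "\<not> (k X0 \<ge> 0 \<and> k X1 + k X0 \<le> - k X2 - 1)"
        unfolding D by (subst taylor_binpow_minus) (use that in auto)
      moreover have "U (m - k) = 0" if "k X1 \<noteq> m X1"
        by (rule U) (use that in simp)
      ultimately show ?thesis using False by blast
    qed
  qed
  also have "\<dots> = (\<Sum>(i, j)\<in>?W. nuterm (trinom (int K) i j) j
        (U (m - (\<lambda>_. 0)(X0 := int i, X1 := - int K - 1, X2 := int K - int i - int j))))"
    by (intro sum.cong refl) (simp only: split_beta f nuterm_def prod.case)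
  finally show ?thesis .
qed

text \<open>This delta function is expanded in nonnegative powers of x1, so only the coefficients of
  \<open>U\<close> with exponent of x1 at most \<open>m X1\<close> are reached, and these
  vanish.\<close>

lemma delta_reversed_product_coeff:
  assumes U: "\<And>k. k X1 \<le> m X1 \<Longrightarrow> U k = 0"
  shows "fmul scale (xpow X0 (-1) \<odot> delta_quot (taylor (binpow (-1) X2 X1) nu) (neg_pow (xpow X0))) U m = 0"
proof -
  let ?T = "taylor (binpow (-1) X2 X1) nu"
  let ?D = "xpow X0 (-1) \<odot> delta_quot ?T (neg_pow (xpow X0))"
  have D: "?D k = (\<lambda>S. ((-1) powi (k X0 + 1)) * ?T (- k X0 - 1) (k(X0 := 0)) S)" for k
    by (rule delta_quot_eq)
      (auto simp: taylor_binpow flat_nu neg_pow_def fscale_def xpow_eq ext_scalar_def)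
  have "fmul scale ?D U m = (\<Sum>x\<in>{}. ?D x \<bullet> U (m - x))"
  proof (rule fmul_sum)
    fix k
    have "?D k = 0" if "k X1 < 0"
      unfolding D by (subst taylor_binpow) (use that in \<open>auto simp: flat_nu zero_fun_def\<close>)
    moreover have "U (m - k) = 0" if "k X1 \<ge> 0"
      by (rule U) (use that in simp)
    ultimately show "?D k = 0 \<or> U (m - k) = 0" by linarith
  qed auto
  then show ?thesis by (simp only: sum.empty)
qed

end


section \<open>Coefficients of vertex operators\<close>

lemma gconst_add: "gconst (a + b) = gconst a + gconst b"
  by (rule grassmann_eqI) (simp add: gcoeff_add gcoeff_gconst)

lemma gconst_mult: "gconst (a * b) = gconst a * gconst b"
proof (rule grassmann_eqI)
  fix S :: "nat set" assume S: "finite S"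
  have "gcoeff (gconst a * gconst b) S = (\<Sum>T\<in>Pow S. if T = {} then (if S = {} then a * b else 0) else 0)"
    unfolding gcoeff_mult ext_mult_def by (intro sum.cong) (auto simp: gcoeff_gconst)
  with S show "gcoeff (gconst (a * b)) S = gcoeff (gconst a * gconst b) S"
    by (simp add: gcoeff_gconst)
qed

lemma gconst_Grass: "gconst c \<in> Grass L"
  by (simp add: Grass_def gcoeff_gconst)

text \<open>The scalars \<open>gconst c\<close> lie in every \<open>Grass L\<close>, so the module
  axioms apply to them.\<close>

sublocale graded_module \<subseteq> cspace "cscale act"
proof
  fix a b y z
  show "cscale act a (y + z) = cscale act a y + cscale act a z"
    by (simp add: cscale_def act_add_right gconst_Grass)
  show "cscale act (a + b) z = cscale act a z + cscale act b z"
    by (simp add: cscale_def gconst_add act_add_left gconst_Grass)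
  show "cscale act a (cscale act b z) = cscale act (a * b) z"
    by (simp add: cscale_def gconst_mult act_mult gconst_Grass)
  show "cscale act 1 z = z"
    using act_one[of z] by (simp add: cscale_def one_grassmann_def)
qed

context graded_module
begin

notation eact (infixr "\<bullet>" 70)

section \<open>Parity and endomorphisms acting on coefficients\<close>

lemma decompose:
  obtains z0 z1 where "z0 \<in> V 0" "z1 \<in> V 1" "z = z0 + z1"
  using direct_sum[of z] by auto

lemma grade_inv_eq:
  assumes "z0 \<in> V 0" "z1 \<in> V 1"
  shows "grade_inv V (z0 + z1) = z0 - z1"
  unfolding grade_inv_def
proof (rule the_equality)
  fix y assume "\<exists>y0\<in>V 0. \<exists>y1\<in>V 1. z0 + z1 = y0 + y1 \<and> y = y0 - y1"
  then obtain y0 y1 where y: "y0 \<in> V 0" "y1 \<in> V 1" "z0 + z1 = y0 + y1" "y = y0 - y1" by auto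
  let ?Q = "\<lambda>(a, b). a \<in> V 0 \<and> b \<in> V 1 \<and> z0 + z1 = a + b"
  have "\<exists>!p. ?Q p" by (rule direct_sum)
  moreover have "?Q (y0, y1)" "?Q (z0, z1)" using y assms by simp_all
  ultimately have "(y0, y1) = (z0, z1)" by blast
  with y show "y = z0 - z1" by simp
qed (use assms in blast)

lemma grade_inv_add: "grade_inv V (y + z) = grade_inv V y + grade_inv V z"
proof -
  obtain y0 y1 z0 z1 where yz: "y0 \<in> V 0" "y1 \<in> V 1" "y = y0 + y1" "z0 \<in> V 0" "z1 \<in> V 1" "z = z0 + z1"
    using decompose by metis
  then have "grade_inv V (y + z) = (y0 + z0) - (y1 + z1)"
    using grade_inv_eq[of "y0 + z0" "y1 + z1"] by (simp add: part_add algebra_simps)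
  with yz show ?thesis by (simp add: grade_inv_eq)
qed

lemma grade_inv_zero: "grade_inv V 0 = 0"
  using grade_inv_add[of 0 0] by simp

definition ext_apply :: "('v \<Rightarrow> 'v) \<Rightarrow> (ovar set \<Rightarrow> 'v) \<Rightarrow> ovar set \<Rightarrow> 'v" where
  "ext_apply f h = (\<lambda>S. if even (card S) then f (h S) else grade_inv V (f (grade_inv V (h S))))"

lemma apply_endo_eq: "apply_endo V f F m = ext_apply f (F m)"
  by (simp add: apply_endo_def ext_apply_def)

definition single :: "'v \<Rightarrow> ovar set \<Rightarrow> 'v" where
  "single w = (\<lambda>S. if S = {} then w else 0)"

lemma single_add: "single (y + z) = single y + single z"
  by (auto simp: single_def)

lemma const_single: "const w m = (if m = 0 then single w else 0)"
  by (simp add: const_eq single_def)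

lemma ext_apply_add_left: "ext_apply (\<lambda>z. f z + g z) h = ext_apply f h + ext_apply g h"
  by (auto simp: ext_apply_def grade_inv_add)

lemma ext_apply_add_right:
  "(\<And>y z. f (y + z) = f y + f z) \<Longrightarrow> ext_apply f (h + h') = ext_apply f h + ext_apply f h'"
  by (auto simp: ext_apply_def grade_inv_add)

lemma ext_apply_zero: "f 0 = 0 \<Longrightarrow> ext_apply f 0 = 0"
  by (auto simp: ext_apply_def grade_inv_zero)

lemma ext_apply_single: "f 0 = 0 \<Longrightarrow> ext_apply f (single w) = single (f w)"
  by (auto simp: ext_apply_def single_def grade_inv_zero)

text \<open>A series in the odd variables alone shifts no exponent, so both products run over the
  same finite set and associativity applies term by term. It serves to pull the odd monomials out of
  vertex operators.\<close>

lemma fmul_flat_mult: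
  assumes "flat e" "finite {k. g k \<noteq> 0 \<and> G (m - k) \<noteq> 0}"
  shows "fmul (cscale act) (e \<odot> g) G m = e 0 \<bullet> fmul (cscale act) g G m"
proof -
  let ?A = "{k. g k \<noteq> 0 \<and> G (m - k) \<noteq> 0}"
  have eg: "(e \<odot> g) k = ext_mult (e 0) (g k)" for k
    using complex_cspace.fmul_flat_left[OF assms(1)] by (simp add: ext_act_times)
  have "fmul (cscale act) (e \<odot> g) G m = (\<Sum>k\<in>?A. (e \<odot> g) k \<bullet> G (m - k))"
  proof (rule fmul_sum[where \<kappa> = "\<lambda>k. k", OF assms(2)])
    fix k assume "k \<notin> (\<lambda>k. k) ` ?A"
    then have "g k = 0 \<or> G (m - k) = 0" by simp
    moreover have "(e \<odot> g) k = 0" if "g k = 0"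
      using complex_cspace.eact_zero(2)[of "e 0"] by (simp only: eg that ext_act_times)
    ultimately show "(e \<odot> g) k = 0 \<or> G (m - k) = 0" by blast
  qed simp
  moreover have "fmul (cscale act) g G m = (\<Sum>k\<in>?A. g k \<bullet> G (m - k))"
    by (rule fmul_sum[where \<kappa> = "\<lambda>k. k", OF assms(2)]) auto
  ultimately show ?thesis
    by (simp only: eact_sum eg eact_eact)
qed

end

context N2_vertex_data
begin

text \<open>The sign axiom gives additivity for homogeneous \<open>u\<close>; the general case
  follows by splitting \<open>u\<close> into its two parts.\<close>

lemma Y_add_right: "Y u P n (y + z) = Y u P n y + Y u P n z"
proof -
  obtain u0 u1 where u: "u0 \<in> V 0" "u1 \<in> V 1" "u = u0 + u1" by (rule decompose)
  then have "Y u0 P n (y + z) = Y u0 P n y + Y u0 P n z" "Y u1 P n (y + z) = Y u1 P n y + Y u1 P n z"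
    using Y_sign[of u0 0 P n] Y_sign[of u1 1 P n] by (auto simp: End_part_def)
  with u show ?thesis by (simp add: Y_add)
qed

lemma Y_zero: "Y u P n 0 = 0" "Y 0 P n z = 0"
  using Y_add_right[of u P n 0 0] Y_add[of 0 0 P n z] by simp_all

text \<open>The coefficient of \<open>x^q\<close> in \<open>Y(u, (x, \<theta>))\<close> applied to
  \<open>h\<close>. It is indexed by the exponent \<open>q\<close>, which belongs to the mode number
  \<open>- q - 1\<close>.\<close>

definition mode :: "(pm \<Rightarrow> complex series) \<Rightarrow> 'v \<Rightarrow> int \<Rightarrow> (ovar set \<Rightarrow> 'v) \<Rightarrow> ovar set \<Rightarrow> 'v" where
  "mode \<theta> u q h = (\<Sum>P\<in>UNIV. odd_mon \<theta> P 0 \<bullet> ext_apply (Y u P (- q - 1)) h)"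

lemma mode_add_left: "mode \<theta> (u + u') q h = mode \<theta> u q h + mode \<theta> u' q h"
proof -
  have "Y (u + u') P n = (\<lambda>z. Y u P n z + Y u' P n z)" for P n
    by (rule ext) (rule Y_add)
  then show ?thesis
    by (simp only: mode_def ext_apply_add_left eact_add sum.distrib)
qed

lemma mode_add_right: "mode \<theta> u q (h + h') = mode \<theta> u q h + mode \<theta> u q h'"
  by (simp only: mode_def ext_apply_add_right Y_add_right eact_add sum.distrib)

lemma mode_zero: "mode \<theta> u q 0 = 0" "mode \<theta> 0 q h = 0"
  using mode_add_right[of \<theta> u q 0 0] mode_add_left[of \<theta> 0 0 q h] by simp_all

lemma mode_truncation:
  assumes "truncation Y"
  obtains Q where "\<And>\<theta> q. q < Q \<Longrightarrow> mode \<theta> u q (single w) = 0"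
proof -
  obtain N where N: "\<And>n P. n \<ge> N \<Longrightarrow> Y u P n w = 0"
    using assms unfolding truncation_def by blast
  have "mode \<theta> u q (single w) = 0" if "q < - N" for \<theta> q
  proof -
    have "ext_apply (Y u P (- q - 1)) (single w) = 0" for P
      using N[of "- q - 1" P] that by (simp add: ext_apply_single Y_zero) (simp add: single_def zero_fun_def)
    then show ?thesis
      unfolding mode_def by (simp only: eact_zero sum.neutral_const)
  qed
  then show thesis by (rule that)
qed

text \<open>\<open>F\<close> does not involve \<open>a\<close>, so the exponent of \<open>a\<close>
  selects the single mode \<open>n = - m a - 1\<close>.\<close>

lemma vop_xpow:
  assumes \<theta>: "\<And>s. flat (\<theta> s)" and F: "\<And>m. m a \<noteq> 0 \<Longrightarrow> F m = 0"
  shows "vop act V Y u (xpow a) \<theta> F m = mode \<theta> u (m a) (F (m(a := 0)))"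
proof
  fix S
  have summand: "fmul (cscale act) (odd_mon \<theta> P \<odot> xpow a (- n - 1)) (apply_endo V (Y u P n) F) m
      = odd_mon \<theta> P 0 \<bullet> ext_apply (Y u P n) (F (m - (\<lambda>_. 0)(a := - n - 1)))" for n P
  proof -
    have eq: "(odd_mon \<theta> P \<odot> xpow a (- n - 1)) k
        = (if k = (\<lambda>_. 0)(a := - n - 1) then odd_mon \<theta> P 0 else 0)" for k
      unfolding complex_cspace.fmul_flat_left[OF flat_odd_mon[OF \<theta>]] ext_act_times xpow_eq
      using complex_cspace.eact_zero(2)[of "odd_mon \<theta> P 0"]
      by (simp add: ext_mult_scalar ext_act_times)
    show ?thesis
      by (subst fmul_single[of "(\<lambda>_. 0)(a := - n - 1)"]) (simp_all only: eq apply_endo_eq if_True if_False simp_thms)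
  qed
  have "vop act V Y u (xpow a) \<theta> F m S = Sum_any (\<lambda>n. (\<Sum>P\<in>UNIV.
      odd_mon \<theta> P 0 \<bullet> ext_apply (Y u P n) (F (m - (\<lambda>_. 0)(a := - n - 1)))) S)"
    unfolding vop_def fsum_def sum_fun_apply summand ..
  also have "\<dots> = (\<Sum>P\<in>UNIV. odd_mon \<theta> P 0 \<bullet> ext_apply (Y u P (- m a - 1))
      (F (m - (\<lambda>_. 0)(a := - (- m a - 1) - 1)))) S"
  proof (rule Sum_any_single)
    fix n assume "n \<noteq> - m a - 1"
    then have "F (m - (\<lambda>_. 0)(a := - n - 1)) = 0"
      by (intro F) simp
    then show "(\<Sum>P\<in>UNIV. odd_mon \<theta> P 0 \<bullet> ext_apply (Y u P n) (F (m - (\<lambda>_. 0)(a := - n - 1)))) S = 0"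
      by (simp only: ext_apply_zero Y_zero eact_zero sum.neutral_const zero_fun_apply)
  qed
  also have "m - (\<lambda>_. 0)(a := - (- m a - 1) - 1) = m(a := 0)"
    by auto
  finally show "vop act V Y u (xpow a) \<theta> F m S = mode \<theta> u (m a) (F (m(a := 0))) S"
    by (simp only: mode_def)
qed

lemma vop_const:
  assumes "\<And>s. flat (\<theta> s)"
  shows "vop act V Y u (xpow a) \<theta> (const w) m
    = (if \<forall>c. c \<noteq> a \<longrightarrow> m c = 0 then mode \<theta> u (m a) (single w) else 0)"
proof -
  have "m(a := 0) = 0 \<longleftrightarrow> (\<forall>c. c \<noteq> a \<longrightarrow> m c = 0)"
    by (auto simp: fun_eq_iff)
  moreover have "vop act V Y u (xpow a) \<theta> (const w) m = mode \<theta> u (m a) (const w (m(a := 0)))"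
    by (rule vop_xpow[OF assms]) (auto simp: const_single)
  ultimately have "vop act V Y u (xpow a) \<theta> (const w) m
      = mode \<theta> u (m a) (if \<forall>c. c \<noteq> a \<longrightarrow> m c = 0 then single w else 0)"
    by (simp only: const_single)
  then show ?thesis
    by (simp only: if_distrib[of "mode \<theta> u (m a)"] mode_zero)
qed

lemma vop_vop_const:
  assumes "\<And>s. flat (\<theta> s)" "\<And>s. flat (\<theta>' s)" "a \<noteq> b"
  shows "vop act V Y u (xpow a) \<theta> (vop act V Y v (xpow b) \<theta>' (const w)) m
    = (if \<forall>c. c \<noteq> a \<longrightarrow> c \<noteq> b \<longrightarrow> m c = 0
       then mode \<theta> u (m a) (mode \<theta>' v (m b) (single w)) else 0)"
proof -
  let ?F = "vop act V Y v (xpow b) \<theta>' (const w)"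
  have F: "?F k = (if \<forall>c. c \<noteq> b \<longrightarrow> k c = 0 then mode \<theta>' v (k b) (single w) else 0)" for k
    by (rule vop_const[OF assms(2)])
  have "vop act V Y u (xpow a) \<theta> ?F m = mode \<theta> u (m a) (?F (m(a := 0)))"
    by (rule vop_xpow[OF assms(1)]) (use assms(3) in \<open>auto simp: F\<close>)
  moreover have "(\<forall>c. c \<noteq> b \<longrightarrow> (m(a := 0)) c = 0) \<longleftrightarrow> (\<forall>c. c \<noteq> a \<longrightarrow> c \<noteq> b \<longrightarrow> m c = 0)"
    by auto
  moreover have "(m(a := 0)) b = m b"
    using assms(3) by simp
  ultimately show ?thesis
    unfolding F by (simp only: mode_zero split: if_split) blast
qed

text \<open>The coefficient of \<open>x0^a x2^b\<close> in the iterate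
  \<open>Y(Y(u, (x0, \<theta>))v, (x2, \<theta>'))w\<close>; \<open>T\<close> holds the odd
  variables produced by the inner operator.\<close>

definition iter :: "(pm \<Rightarrow> complex series) \<Rightarrow> (pm \<Rightarrow> complex series) \<Rightarrow> 'v \<Rightarrow> 'v \<Rightarrow> 'v \<Rightarrow> int \<Rightarrow> int \<Rightarrow> ovar set \<Rightarrow> 'v" where
  "iter \<theta> \<theta>' u v w a b = (\<lambda>S. \<Sum>T\<in>Pow S. cscale act (ext_sgn T (S - T))
     (mode \<theta>' (mode \<theta> u a (single v) T) b (single w) (S - T)))"

lemma iter_add_left: "iter \<theta> \<theta>' (u + u') v w a b = iter \<theta> \<theta>' u v w a b + iter \<theta> \<theta>' u' v w a b"
  by (rule ext) (simp only: iter_def mode_add_left plus_fun_apply scale_right_distrib sum.distrib)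

lemma iter_add_right: "iter \<theta> \<theta>' u (v + v') w a b = iter \<theta> \<theta>' u v w a b + iter \<theta> \<theta>' u v' w a b"
  by (rule ext) (simp only: iter_def single_add mode_add_left mode_add_right plus_fun_apply scale_right_distrib sum.distrib)

lemma vop_series_iterate:
  assumes "\<And>s. flat (\<theta> s)" "\<And>s. flat (\<theta>' s)"
  shows "vop_series act V Y (vop act V Y u (xpow X0) \<theta> (const v)) (xpow X2) \<theta>' (const w) m
    = (if m X1 = 0 then iter \<theta> \<theta>' u v w (m X0) (m X2) else 0)"
proof
  fix S
  let ?G = "vop act V Y u (xpow X0) \<theta> (const v)"
  let ?k = "(\<lambda>_. 0)(X0 := m X0)"
  have G: "?G k = (if \<forall>c. c \<noteq> X0 \<longrightarrow> k c = 0 then mode \<theta> u (k X0) (single v) else 0)" for k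
    by (rule vop_const[OF assms(1)])
  have vop: "vop act V Y z (xpow X2) \<theta>' (const w) k
      = (if \<forall>c. c \<noteq> X2 \<longrightarrow> k c = 0 then mode \<theta>' z (k X2) (single w) else 0)" for z k
    by (rule vop_const[OF assms(2)])
  have "Sum_any (\<lambda>k. cscale act (ext_sgn T (S - T)) (vop act V Y (?G k T) (xpow X2) \<theta>' (const w) (m - k) (S - T)))
      = cscale act (ext_sgn T (S - T)) (vop act V Y (?G ?k T) (xpow X2) \<theta>' (const w) (m - ?k) (S - T))" for T
  proof (rule Sum_any_single)
    fix k assume k: "k \<noteq> ?k"
    have "vop act V Y (?G k T) (xpow X2) \<theta>' (const w) (m - k) = 0"
    proof (cases "\<forall>c. c \<noteq> X0 \<longrightarrow> k c = 0")
      case True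
      with k have "k X0 \<noteq> m X0" by (auto simp: fun_eq_iff split: if_splits)
      then have "\<not> (\<forall>c. c \<noteq> X2 \<longrightarrow> (m - k) c = 0)" by (auto intro!: exI[of _ X0])
      then show ?thesis unfolding vop by (simp only: if_False)
    next
      case False
      then have "?G k T = 0" unfolding G by (simp only: if_False zero_fun_apply)
      then show ?thesis unfolding vop by (simp only: mode_zero if_cancel)
    qed
    then show "cscale act (ext_sgn T (S - T)) (vop act V Y (?G k T) (xpow X2) \<theta>' (const w) (m - k) (S - T)) = 0"
      by (simp only: zero_fun_apply scale_zero_right)
  qed
  moreover have "(\<forall>c. c \<noteq> X2 \<longrightarrow> (m - ?k) c = 0) \<longleftrightarrow> m X1 = 0"
    by (auto intro: evar.exhaust)
  moreover have "?G ?k = mode \<theta> u (m X0) (single v)"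
    unfolding G by simp
  moreover have "(m - ?k) X2 = m X2" by simp
  ultimately show "vop_series act V Y ?G (xpow X2) \<theta>' (const w) m S
      = (if m X1 = 0 then iter \<theta> \<theta>' u v w (m X0) (m X2) else 0) S"
    unfolding vop_series_def iter_def
    by (simp only: vop zero_fun_apply scale_zero_right sum.neutral_const split: if_split) simp
qed

text \<open>Since \<open>F\<close> does not involve x0, each pair \<open>(i, j)\<close> forces the
  power \<open>m X0 + i + j\<close> of \<open>x0 + x2 + nu\<close>, hence one mode. Truncation of
  \<open>F\<close> in x2 bounds \<open>i\<close> by \<open>I\<close>, and nilpotency of
  \<open>nu\<close> bounds \<open>j\<close> by two.\<close>

lemma vop_taylor:
  assumes \<theta>: "\<And>s. flat (\<theta> s)"
    and F: "\<And>k. k X0 \<noteq> 0 \<Longrightarrow> F k = 0" "\<And>k. k X1 \<noteq> 0 \<Longrightarrow> F k = 0"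
    and I: "\<And>k. k X2 < m X2 - int I \<Longrightarrow> F k = 0"
  shows "vop act V Y u (taylor (binpow 1 X0 X2) nu) \<theta> F m = (if m X1 = 0 then
    (\<Sum>i\<le>I. \<Sum>j\<le>2. nuterm (trinom (m X0 + int i + int j) i j) j
      (mode \<theta> u (m X0 + int i + int j) (F ((\<lambda>_. 0)(X2 := m X2 - int i))))) else 0)"
proof
  fix S
  let ?W = "{..I} \<times> {..2::nat}"
  let ?t = "taylor (binpow 1 X0 X2) nu"
  have ae: "apply_endo V (Y u P n) F k = 0" if "F k = 0" for P n k
    using that by (simp only: apply_endo_eq ext_apply_zero Y_zero)
  have t: "k X2 \<ge> 0 \<and> k X1 = 0" if "?t p k \<noteq> 0" for p k
    using that by (auto simp: taylor_binpow flat_nu split: if_splits)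
  have fin: "finite {k. ?t p k \<noteq> 0 \<and> apply_endo V (Y u P n) F (m - k) \<noteq> 0}" for p P n
  proof (rule finite_subset)
    show "finite ((\<lambda>i. (\<lambda>_. 0)(X0 := m X0, X2 := int i)) ` {..I})" by simp
    show "{k. ?t p k \<noteq> 0 \<and> apply_endo V (Y u P n) F (m - k) \<noteq> 0}
        \<subseteq> (\<lambda>i. (\<lambda>_. 0)(X0 := m X0, X2 := int i)) ` {..I}"
    proof
      fix k assume "k \<in> {k. ?t p k \<noteq> 0 \<and> apply_endo V (Y u P n) F (m - k) \<noteq> 0}"
      then have k: "?t p k \<noteq> 0" "F (m - k) \<noteq> 0" using ae by blast+
      then have "k X0 = m X0" "k X2 \<le> int I"
        using F(1)[of "m - k"] I[of "m - k"] by auto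
      with t[OF k(1)] have "k = (\<lambda>_. 0)(X0 := m X0, X2 := int (nat (k X2)))" "nat (k X2) \<le> I"
        by (auto simp: fun_eq_iff) (metis evar.exhaust)
      then show "k \<in> (\<lambda>i. (\<lambda>_. 0)(X0 := m X0, X2 := int i)) ` {..I}" by blast
    qed
  qed
  show "vop act V Y u ?t \<theta> F m S = (if m X1 = 0 then
    (\<Sum>i\<le>I. \<Sum>j\<le>2. nuterm (trinom (m X0 + int i + int j) i j) j
      (mode \<theta> u (m X0 + int i + int j) (F ((\<lambda>_. 0)(X2 := m X2 - int i))))) else 0) S"
  proof (cases "m X1 = 0")
    case False
    \<comment> \<open>Neither the expanded power nor \<open>F\<close> involves x1, so no exponent
      contributes.\<close>
    have "fmul (cscale act) (?t p) (apply_endo V (Y u P n) F) m = (\<Sum>x\<in>{}. ?t p x \<bullet> apply_endo V (Y u P n) F (m - x))"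
      for p P n
    proof (rule fmul_sum)
      fix k show "?t p k = 0 \<or> apply_endo V (Y u P n) F (m - k) = 0"
        using t[of p k] F(2)[of "m - k"] False ae by auto
    qed auto
    then have "fmul (cscale act) (odd_mon \<theta> P \<odot> ?t (- n - 1)) (apply_endo V (Y u P n) F) m = 0" for P n
      by (simp only: fmul_flat_mult[OF flat_odd_mon[OF \<theta>] fin] sum.empty eact_zero)
    then show ?thesis
      using False unfolding vop_def fsum_def by (simp only: sum_fun_apply zero_fun_apply sum.neutral_const Sum_any.neutral if_False)
  next
    case True
    define h where "h = (\<lambda>(i, j). nuterm (trinom (m X0 + int i + int j) i j) j
      (mode \<theta> u (m X0 + int i + int j) (F ((\<lambda>_. 0)(X2 := m X2 - int i)))))"
    \<comment> \<open>\<open>g\<close> is the mode number forced by \<open>(i, j)\<close>;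
      \<open>h'\<close> is the contribution of a single \<open>P\<close> before its odd monomial
      acts, and \<open>h\<close> the total over all \<open>P\<close>.\<close>
    define g where "g = (\<lambda>(i::nat, j::nat). - (m X0 + int i + int j) - 1)"
    define h' where "h' n P = (\<lambda>(i, j). nuterm (trinom (m X0 + int i + int j) i j) j
      (ext_apply (Y u P n) (F ((\<lambda>_. 0)(X2 := m X2 - int i)))))" for n P
    have t_apply: "fmul (cscale act) (?t (- n - 1)) (apply_endo V (Y u P n) F) m
        = (\<Sum>x\<in>?W. if n = g x then h' n P x else 0)" for n P
    proof -
      have "fmul (cscale act) (?t (- n - 1)) (apply_endo V (Y u P n) F) m
        = (\<Sum>(i, j)\<in>?W. nuterm (trinom (- n - 1) i j) j
            (apply_endo V (Y u P n) F (m - (\<lambda>_. 0)(X0 := - n - 1 - int i - int j, X2 := int i))))"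
      proof (rule fmul_taylor_plus)
        fix i j assume "(i, j) \<notin> ?W"
        then have "j > 2 \<or> i > I" by auto
        moreover have "F (m - (\<lambda>_. 0)(X0 := - n - 1 - int i - int j, X2 := int i)) = 0" if "i > I"
          by (rule I) (use that in simp)
        ultimately show "trinom (- n - 1) i j = 0 \<or> j > 2 \<or>
            apply_endo V (Y u P n) F (m - (\<lambda>_. 0)(X0 := - n - 1 - int i - int j, X2 := int i)) = 0"
          using ae by blast
      qed simp
      also have "\<dots> = (\<Sum>x\<in>?W. if n = g x then h' n P x else 0)"
      proof (intro sum.cong refl)
        fix x assume "x \<in> ?W"
        obtain i j where x: "x = (i, j)" by fastforce
        let ?k = "m - (\<lambda>_. 0)(X0 := - n - 1 - int i - int j, X2 := int i)"
        show "(case x of (i, j) \<Rightarrow> nuterm (trinom (- n - 1) i j) j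
            (apply_endo V (Y u P n) F (m - (\<lambda>_. 0)(X0 := - n - 1 - int i - int j, X2 := int i))))
            = (if n = g x then h' n P x else 0)"
        proof (cases "n = g x")
          case n: True
          then have "?k = (\<lambda>_. 0)(X2 := m X2 - int i)"
            using True x by (auto simp: g_def fun_eq_iff) (metis evar.exhaust)
          moreover have "- n - 1 = m X0 + int i + int j"
            using n x by (simp add: g_def)
          ultimately show ?thesis
            using n by (simp only: x prod.case h'_def apply_endo_eq if_True simp_thms)
        next
          case False
          then have "F ?k = 0"
            by (intro F(1)) (simp add: x g_def)
          with False show ?thesis
            by (simp only: x prod.case ae nuterm_zero if_False)
        qed
      qed
      finally show ?thesis .
    qed
    have coeff: "(\<Sum>P\<in>UNIV. fmul (cscale act) (odd_mon \<theta> P \<odot> ?t (- n - 1)) (apply_endo V (Y u P n) F) m)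
        = (\<Sum>x\<in>?W. if n = g x then h x else 0)" for n
    proof -
      have "(\<Sum>P\<in>UNIV. fmul (cscale act) (odd_mon \<theta> P \<odot> ?t (- n - 1)) (apply_endo V (Y u P n) F) m)
          = (\<Sum>x\<in>?W. \<Sum>P\<in>UNIV. odd_mon \<theta> P 0 \<bullet> (if n = g x then h' n P x else 0))"
        by (simp only: fmul_flat_mult[OF flat_odd_mon[OF \<theta>] fin] t_apply eact_sum) (rule sum.swap)
      also have "\<dots> = (\<Sum>x\<in>?W. if n = g x then h x else 0)"
      proof (intro sum.cong refl)
        fix x :: "nat \<times> nat"
        obtain i j where x: "x = (i, j)" by fastforce
        show "(\<Sum>P\<in>UNIV. odd_mon \<theta> P 0 \<bullet> (if n = g x then h' n P x else 0)) = (if n = g x then h x else 0)"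
        proof (cases "n = g x")
          case n: True
          have "n = - (m X0 + int i + int j) - 1"
            using n x by (simp add: g_def)
          then show ?thesis
            unfolding if_P[OF n]
            by (simp only: x h'_def h_def prod.case eact_nuterm nuterm_sum_right mode_def)
        next
          case False
          then show ?thesis by (simp only: if_False eact_zero sum.neutral_const)
        qed
      qed
      finally show ?thesis .
    qed
    have "(\<Sum>P\<in>UNIV. fmul (cscale act) (odd_mon \<theta> P \<odot> ?t (- n - 1)) (apply_endo V (Y u P n) F) m S)
        = (\<Sum>x\<in>?W. if n = g x then h x S else 0)" for n
      using fun_cong[OF coeff[of n], of S] by (simp only: sum_fun_apply if_distribR zero_fun_apply)
    then have "vop act V Y u ?t \<theta> F m S = Sum_any (\<lambda>n. \<Sum>x\<in>?W. if n = g x then h x S else 0)"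
      unfolding vop_def fsum_def by (simp only: sum_fun_apply)
    also have "\<dots> = (\<Sum>x\<in>?W. h x S)"
      by (rule Sum_any_sum_graph) simp
    also have "\<dots> = (\<Sum>i\<le>I. \<Sum>j\<le>2. h (i, j) S)"
      by (simp add: sum.cartesian_product)
    finally show ?thesis
      using True by (simp only: h_def prod.case sum_fun_apply simp_thms if_True)
  qed
qed

end


section \<open>The residue of the Jacobi identity\<close>

lemma flat_phi12: "flat (phi1 s)" "flat (phi2 s)" "flat (phi1 s - phi2 s)"
  by (simp_all add: phi1_def phi2_def flat_phi flat_diff)

context N2_vertex_data
begin

abbreviation product_coeff :: "'v \<Rightarrow> 'v \<Rightarrow> 'v \<Rightarrow> int \<Rightarrow> int \<Rightarrow> ovar set \<Rightarrow> 'v" where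
  "product_coeff u v w p q \<equiv> mode phi1 u p (mode phi2 v q (single w))"

abbreviation iterate_coeff :: "'v \<Rightarrow> 'v \<Rightarrow> 'v \<Rightarrow> int \<Rightarrow> int \<Rightarrow> ovar set \<Rightarrow> 'v" where
  "iterate_coeff \<equiv> iter (\<lambda>s. phi1 s - phi2 s) phi2"

text \<open>
  The coefficients of \<open>x\<^sub>0^a x\<^sub>1^(-K-1) x\<^sub>2^b\<close> in the first term on the left and in the right-hand side
  of the Jacobi identity, written as coefficients of \<open>x\<^sub>0^a x\<^sub>2^b\<close> in the two sides of weak associativity.
\<close>

definition residue_left :: "nat \<Rightarrow> nat \<Rightarrow> 'v \<Rightarrow> 'v \<Rightarrow> 'v \<Rightarrow> int \<Rightarrow> int \<Rightarrow> ovar set \<Rightarrow> 'v" where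
  "residue_left I K u v w a b = (\<Sum>i\<le>I. \<Sum>j\<le>2. nuterm (trinom (a + int i + int j) i j) j
     (product_coeff u v w (a - int K + int i + int j) (b - int i)))"

definition residue_right :: "nat \<Rightarrow> 'v \<Rightarrow> 'v \<Rightarrow> 'v \<Rightarrow> int \<Rightarrow> int \<Rightarrow> ovar set \<Rightarrow> 'v" where
  "residue_right K u v w a b = (\<Sum>(i, j)\<in>{(i, j). i + j \<le> K}. nuterm (trinom (int K) i j) j
     (iterate_coeff u v w (a - int i) (b - int K + int i + int j)))"

lemma residue_left_add:
  "residue_left I K (u + u') v w a b = residue_left I K u v w a b + residue_left I K u' v w a b"
  "residue_left I K u (v + v') w a b = residue_left I K u v w a b + residue_left I K u v' w a b"
  by (simp_all only: residue_left_def mode_add_left mode_add_right nuterm_add sum.distrib)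

lemma residue_right_add:
  "residue_right K (u + u') v w a b = residue_right K u v w a b + residue_right K u' v w a b"
  "residue_right K u (v + v') w a b = residue_right K u v w a b + residue_right K u v' w a b"
  by (simp_all only: residue_right_def iter_add_left iter_add_right nuterm_add case_prod_unfold sum.distrib)

text \<open>The coefficient at \<open>x1^(-K-1)\<close> is the residue in x1 after multiplication by
  \<open>x1^K\<close>. The bound \<open>K\<close> removes the reversed product, and \<open>I\<close>
  makes the sum for the first product finite.\<close>

lemma residue_homogeneous:
  assumes jacobi: "jacobi_identity act V Y" and uv: "u \<in> V r" "v \<in> V s"
    and K: "\<And>q. q < - int K \<Longrightarrow> mode phi1 u q (single w) = 0"
    and I: "\<And>q. q < b - int I \<Longrightarrow> mode phi2 v q (single w) = 0"
  shows "residue_left I K u v w a b = residue_right K u v w a b"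
proof -
  let ?m = "(\<lambda>_. 0)(X0 := a, X1 := - int K - 1, X2 := b)"
  let ?U1 = "vop act V Y u (xpow X1) phi1 (vop act V Y v (xpow X2) phi2 (const w))"
  let ?U2 = "vop act V Y v (xpow X2) phi2 (vop act V Y u (xpow X1) phi1 (const w))"
  let ?U3 = "vop_series act V Y (vop act V Y u (xpow X0) (\<lambda>s. phi1 s - phi2 s) (const v)) (xpow X2) phi2 (const w)"
  let ?J1 = "fmul (cscale act)
       (xpow X0 (-1) \<odot> delta_quot (taylor (binpow (-1) X1 X2) (- nu)) (xpow X0)) ?U1"
  let ?J2 = "fmul (cscale act)
       (xpow X0 (-1) \<odot> delta_quot (taylor (binpow (-1) X2 X1) nu) (neg_pow (xpow X0))) ?U2"
  let ?J3 = "fmul (cscale act)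
       (xpow X2 (-1) \<odot> delta_quot (taylor (binpow (-1) X1 X0) (- nu)) (xpow X2)) ?U3"
  have U1: "?U1 k = (if \<forall>c. c \<noteq> X1 \<longrightarrow> c \<noteq> X2 \<longrightarrow> k c = 0 then product_coeff u v w (k X1) (k X2) else 0)" for k
    by (rule vop_vop_const) (simp_all add: flat_phi12)
  have U2: "?U2 k = (if \<forall>c. c \<noteq> X2 \<longrightarrow> c \<noteq> X1 \<longrightarrow> k c = 0
      then mode phi2 v (k X2) (mode phi1 u (k X1) (single w)) else 0)" for k
    by (rule vop_vop_const) (simp_all add: flat_phi12)
  have U3: "?U3 k = (if k X1 = 0 then iterate_coeff u v w (k X0) (k X2) else 0)" for k
    by (rule vop_series_iterate) (simp_all add: flat_phi12)
  have "?J1 - koszul (r * s) ?J2 = ?J3"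
    using jacobi uv unfolding jacobi_identity_def by blast
  from fun_cong[OF this, of ?m] have "?J1 ?m - koszul (r * s) ?J2 ?m = ?J3 ?m"
    by simp
  moreover have "?J2 ?m = 0"
  proof (rule delta_reversed_product_coeff)
    fix k assume "k X1 \<le> ?m X1"
    then have "mode phi1 u (k X1) (single w) = 0" by (intro K) simp
    then show "?U2 k = 0" by (simp only: U2 mode_zero if_cancel)
  qed
  then have "koszul (r * s) ?J2 ?m = 0"
    by (auto simp: koszul_def)
  moreover have "?J1 ?m = residue_left I K u v w a b"
  proof -
    have "?J1 ?m = (\<Sum>(i, j)\<in>{..I} \<times> {..2}. nuterm (trinom (?m X0 + int i + int j) i j) j
        (?U1 (?m - (\<lambda>_. 0)(X0 := ?m X0, X1 := - ?m X0 - 1 - int i - int j, X2 := int i))))"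
    proof (rule delta_product_coeff)
      fix k :: "evar \<Rightarrow> int" assume "k X0 \<noteq> 0"
      then show "?U1 k = 0" by (auto simp: U1)
    next
      fix i j assume "(i, j) \<notin> {..I} \<times> {..2::nat}"
      then have "j > 2 \<or> i > I" by auto
      moreover have "?U1 (?m - (\<lambda>_. 0)(X0 := ?m X0, X1 := - ?m X0 - 1 - int i - int j, X2 := int i)) = 0"
        if "i > I"
      proof -
        have "mode phi2 v (b - int i) (single w) = 0" by (rule I) (use that in simp)
        then show ?thesis by (simp add: U1) (simp add: mode_zero flip: zero_fun_def)
      qed
      ultimately show "j > 2 \<or>
          ?U1 (?m - (\<lambda>_. 0)(X0 := ?m X0, X1 := - ?m X0 - 1 - int i - int j, X2 := int i)) = 0"
        by blast
    qed simp
    also have "\<dots> = residue_left I K u v w a b"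
    proof -
      have "?U1 (?m - (\<lambda>_. 0)(X0 := ?m X0, X1 := - ?m X0 - 1 - int i - int j, X2 := int i))
          = product_coeff u v w (a - int K + int i + int j) (b - int i)" for i j
        by (simp add: U1 algebra_simps)
      then show ?thesis
        unfolding residue_left_def by (simp only: sum.cartesian_product) simp
    qed
    finally show ?thesis .
  qed
  moreover have "?J3 ?m = residue_right K u v w a b"
  proof -
    have "?J3 ?m = (\<Sum>(i, j)\<in>{(i, j). i + j \<le> K}. nuterm (trinom (int K) i j) j
        (?U3 (?m - (\<lambda>_. 0)(X0 := int i, X1 := - int K - 1, X2 := int K - int i - int j))))"
      by (rule delta_iterate_coeff) (simp_all add: U3)
    moreover have "?U3 (?m - (\<lambda>_. 0)(X0 := int i, X1 := - int K - 1, X2 := int K - int i - int j))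
          = iterate_coeff u v w (a - int i) (b - int K + int i + int j)" for i j
      by (simp add: U3 algebra_simps)
    ultimately show ?thesis by (simp only: residue_right_def)
  qed
  ultimately show ?thesis by (simp only: diff_zero)
qed

text \<open>Both residues are additive in \<open>u\<close> and \<open>v\<close>, so homogeneous
  parts suffice. \<open>K\<close> comes from \<open>u\<close> and \<open>w\<close> alone; the
  dependence on \<open>v\<close> is confined to the bound \<open>Q v\<close>, which governs only
  \<open>I\<close>.\<close>

lemma residue:
  assumes jacobi: "jacobi_identity act V Y" and trunc: "truncation Y"
  obtains K Q where "K > 0"
    "\<And>v q. q < Q v \<Longrightarrow> mode phi2 v q (single w) = 0"
    "\<And>v a b I. b - int I \<le> Q v \<Longrightarrow> residue_left I K u v w a b = residue_right K u v w a b"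
proof -
  have part: "\<exists>z0 z1. z0 \<in> V 0 \<and> z1 \<in> V 1 \<and> z = z0 + z1" for z
    using decompose[of z] by metis
  obtain p :: "'v \<Rightarrow> bit \<Rightarrow> 'v" where p: "p z 0 \<in> V 0" "p z 1 \<in> V 1" "z = p z 0 + p z 1" for z
  proof -
    obtain f g where "\<forall>z. f z \<in> V 0 \<and> g z \<in> V 1 \<and> z = f z + g z"
      using part by metis
    then show thesis by (intro that[of "\<lambda>z i. if i = 0 then f z else g z"]) auto
  qed
  have "\<exists>Q. \<forall>\<theta> q. q < Q \<longrightarrow> mode \<theta> v q (single w) = 0" for v
    by (rule mode_truncation[OF trunc, of v w]) blast
  then obtain Q0 where Q0: "\<And>v \<theta> q. q < Q0 v \<Longrightarrow> mode \<theta> v q (single w) = 0"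
    by metis
  \<comment> \<open>Large enough for both homogeneous parts of \<open>u\<close>; \<open>Suc\<close>
    makes it positive.\<close>
  define K where "K = Suc (nat (- Q0 (p u 0)) + nat (- Q0 (p u 1)))"
  have K: "- int K \<le> Q0 (p u 0)" "- int K \<le> Q0 (p u 1)"
    unfolding K_def by linarith+
  \<comment> \<open>The bound covers \<open>v\<close> itself for the truncation claim and its two
    parts for the homogeneous residues.\<close>
  define Q where "Q v = min (Q0 v) (min (Q0 (p v 0)) (Q0 (p v 1)))" for v
  show thesis
  proof (rule that)
    show "K > 0" by (simp add: K_def)
    show "mode phi2 v q (single w) = 0" if "q < Q v" for v q
      by (rule Q0) (use that in \<open>simp add: Q_def\<close>)
    fix v a b and I :: nat assume I: "b - int I \<le> Q v"
    have "residue_left I K (p u r) (p v s) w a b = residue_right K (p u r) (p v s) w a b" for r s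
    proof (rule residue_homogeneous[OF jacobi])
      have "r = 0 \<or> r = 1" "s = 0 \<or> s = 1" by (cases r; simp)+ (cases s; simp)
      then show "p u r \<in> V r" "p v s \<in> V s" using p by auto
      show "mode phi1 (p u r) q (single w) = 0" if "q < - int K" for q
        by (rule Q0) (use that \<open>r = 0 \<or> r = 1\<close> K in auto)
      show "mode phi2 (p v s) q (single w) = 0" if "q < b - int I" for q
        by (rule Q0) (use that I \<open>s = 0 \<or> s = 1\<close> in \<open>auto simp: Q_def\<close>)
    qed
    then have "residue_left I K (p u 0 + p u 1) (p v 0 + p v 1) w a b
        = residue_right K (p u 0 + p u 1) (p v 0 + p v 1) w a b"
      by (simp only: residue_left_add residue_right_add)
    then show "residue_left I K u v w a b = residue_right K u v w a b"
      by (simp only: p(3)[symmetric])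
  qed
qed

section \<open>The two sides of weak associativity as residues\<close>

lemma iterate_side:
  "fmul (cscale act) (taylor (binpow 1 X0 X2) nu (int K))
     (vop_series act V Y (vop act V Y u (xpow X0) (\<lambda>s. phi1 s - phi2 s) (const v)) (xpow X2) phi2 (const w)) m
   = (if m X1 = 0 then residue_right K u v w (m X0) (m X2) else 0)"
proof -
  let ?U = "vop_series act V Y (vop act V Y u (xpow X0) (\<lambda>s. phi1 s - phi2 s) (const v)) (xpow X2) phi2 (const w)"
  let ?W = "{(i, j). i + j \<le> K}"
  have U: "?U k = (if k X1 = 0 then iterate_coeff u v w (k X0) (k X2) else 0)" for k
    by (rule vop_series_iterate) (simp_all add: flat_phi12)
  have W: "finite ?W"
    by (rule finite_subset[of _ "{..K} \<times> {..K}"]) auto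
  have "fmul (cscale act) (taylor (binpow 1 X0 X2) nu (int K)) ?U m
      = (\<Sum>(i, j)\<in>?W. nuterm (trinom (int K) i j) j
          (?U (m - (\<lambda>_. 0)(X0 := int K - int i - int j, X2 := int i))))"
    by (rule fmul_taylor_plus[OF W]) (simp add: trinom_of_nat_eq_0)
  also have "\<dots> = (if m X1 = 0 then (\<Sum>(i, j)\<in>?W. nuterm (trinom (int K) i j) j
          (iterate_coeff u v w (m X0 - (int K - int i - int j)) (m X2 - int i))) else 0)"
  proof (cases "m X1 = 0")
    case True
    then have "?U (m - (\<lambda>_. 0)(X0 := int K - int i - int j, X2 := int i))
        = iterate_coeff u v w (m X0 - (int K - int i - int j)) (m X2 - int i)" for i j
      by (simp add: U)
    with True show ?thesis by (simp only: simp_thms if_True)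
  next
    case False
    then have "?U (m - (\<lambda>_. 0)(X0 := int K - int i - int j, X2 := int i)) = 0" for i j
      by (simp add: U)
    with False show ?thesis by (simp only: if_False nuterm_zero case_prod_unfold sum.neutral_const)
  qed
  \<comment> \<open>The power is a polynomial, so it can be indexed by the exponent
    \<open>K - i - j\<close> of x0 in place of the exponent \<open>i\<close> of x2;
    \<open>trinom_of_nat_reflect\<close> matches the coefficients.\<close>
  also have "(\<Sum>(i, j)\<in>?W. nuterm (trinom (int K) i j) j
          (iterate_coeff u v w (m X0 - (int K - int i - int j)) (m X2 - int i)))
      = residue_right K u v w (m X0) (m X2)"
    unfolding residue_right_def
    by (rule sum.reindex_bij_witness[where i = "\<lambda>(i, j). (K - i - j, j)" and j = "\<lambda>(i, j). (K - i - j, j)"])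
      (auto simp: trinom_of_nat_reflect of_nat_diff algebra_simps)
  finally show ?thesis .
qed

text \<open>The factor \<open>(x0 + x2 + nu)^K\<close> merges with the expanded powers inside the
  vertex operator by \<open>nuterm_Vandermonde\<close>. \<open>I\<close> bounds the powers of x2 in
  both factors, hence \<open>K \<le> I\<close> besides the truncation bound.\<close>

lemma product_side:
  assumes I: "K \<le> I" "\<And>q. q < m X2 - int I \<Longrightarrow> mode phi2 v q (single w) = 0"
  shows "fmul (cscale act) (taylor (binpow 1 X0 X2) nu (int K))
     (vop act V Y u (taylor (binpow 1 X0 X2) nu) phi1 (vop act V Y v (xpow X2) phi2 (const w))) m
   = (if m X1 = 0 then residue_left I K u v w (m X0) (m X2) else 0)"
proof -
  let ?F = "vop act V Y v (xpow X2) phi2 (const w)"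
  let ?U = "vop act V Y u (taylor (binpow 1 X0 X2) nu) phi1 ?F"
  have F: "?F k = (if \<forall>c. c \<noteq> X2 \<longrightarrow> k c = 0 then mode phi2 v (k X2) (single w) else 0)" for k
    by (rule vop_const) (simp add: flat_phi12)
  have F0: "?F k = 0" if "k X2 < m X2 - int I" for k
    using I(2)[OF that] by (simp only: F if_cancel)
  \<comment> \<open>Multiplication by nonnegative powers of x2 only reaches exponents
    \<open>k X2 \<le> m X2\<close>, for which the same \<open>I\<close> is still a valid
    bound.\<close>
  have U: "?U k = (if k X1 = 0 then
    (\<Sum>i\<le>I. \<Sum>j\<le>2. nuterm (trinom (k X0 + int i + int j) i j) j
      (product_coeff u v w (k X0 + int i + int j) (k X2 - int i))) else 0)" if "k X2 \<le> m X2" for k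
  proof -
    have "?U k = (if k X1 = 0 then
      (\<Sum>i\<le>I. \<Sum>j\<le>2. nuterm (trinom (k X0 + int i + int j) i j) j
        (mode phi1 u (k X0 + int i + int j) (?F ((\<lambda>_. 0)(X2 := k X2 - int i))))) else 0)"
    proof (rule vop_taylor)
      fix l :: "evar \<Rightarrow> int"
      show "?F l = 0" if "l X2 < k X2 - int I"
        by (rule F0) (use that \<open>k X2 \<le> m X2\<close> in linarith)
    qed (auto simp: F flat_phi12)
    moreover have "?F ((\<lambda>_. 0)(X2 := k X2 - int i)) = mode phi2 v (k X2 - int i) (single w)" for i
      by (simp add: F)
    ultimately show ?thesis by (simp only:)
  qed
  have "fmul (cscale act) (taylor (binpow 1 X0 X2) nu (int K)) ?U m
      = (\<Sum>(i, j)\<in>{..I} \<times> {..2}. nuterm (trinom (int K) i j) j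
          (?U (m - (\<lambda>_. 0)(X0 := int K - int i - int j, X2 := int i))))"
  proof (rule fmul_taylor_plus)
    fix i j assume "(i, j) \<notin> {..I} \<times> {..2::nat}"
    then have "j > 2 \<or> i + j > K" using I(1) by auto
    then show "trinom (int K) i j = 0 \<or> j > 2 \<or>
        ?U (m - (\<lambda>_. 0)(X0 := int K - int i - int j, X2 := int i)) = 0"
      using trinom_of_nat_eq_0 by blast
  qed simp
  also have "\<dots> = (if m X1 = 0 then residue_left I K u v w (m X0) (m X2) else 0)"
  proof (cases "m X1 = 0")
    case True
    have "?U (m - (\<lambda>_. 0)(X0 := int K - int i - int j, X2 := int i))
        = (\<Sum>i'\<le>I. \<Sum>j'\<le>2. nuterm (trinom (m X0 - (int K - int i - int j) + int i' + int j') i' j') j'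
            (product_coeff u v w (m X0 - (int K - int i - int j) + int i' + int j') (m X2 - int i - int i')))"
      for i j
      by (subst U) (simp_all add: True)
    then have "(\<Sum>(i, j)\<in>{..I} \<times> {..2}. nuterm (trinom (int K) i j) j
          (?U (m - (\<lambda>_. 0)(X0 := int K - int i - int j, X2 := int i))))
        = residue_left I K u v w (m X0) (m X2)"
      unfolding residue_left_def sum.cartesian_product[symmetric]
      by (simp only:) (rule nuterm_Vandermonde, simp only: I(2) mode_zero)
    with True show ?thesis by (simp only: simp_thms if_True)
  next
    case False
    have "?U (m - (\<lambda>_. 0)(X0 := int K - int i - int j, X2 := int i)) = 0" for i j
      by (subst U) (simp_all add: False)
    with False show ?thesis by (simp only: if_False nuterm_zero case_prod_unfold sum.neutral_const)
  qed
  finally show ?thesis .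
qed

theorem weak_associativity_of_jacobi:
  assumes "jacobi_identity act V Y" "truncation Y"
  shows "weak_associativity act V Y"
  unfolding weak_associativity_def
proof (intro allI)
  fix u w
  obtain K Q where K: "K > 0"
    and Q: "\<And>v q. q < Q v \<Longrightarrow> mode phi2 v q (single w) = 0"
    and res: "\<And>v a b I. b - int I \<le> Q v \<Longrightarrow> residue_left I K u v w a b = residue_right K u v w a b"
    using residue[OF assms, of w u] by metis
  have "fmul (cscale act) (taylor (binpow 1 X0 X2) nu (int K))
       (vop_series act V Y (vop act V Y u (xpow X0) (\<lambda>s. phi1 s - phi2 s) (const v)) (xpow X2) phi2 (const w)) m
     = fmul (cscale act) (taylor (binpow 1 X0 X2) nu (int K))
        (vop act V Y u (taylor (binpow 1 X0 X2) nu) phi1 (vop act V Y v (xpow X2) phi2 (const w))) m" for v m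
  proof -
    \<comment> \<open>\<open>I\<close> may vary with \<open>v\<close> and with the coefficient
      \<open>m\<close>, whereas \<open>K\<close> is fixed before \<open>v\<close>, as the order of
      quantifiers demands.\<close>
    define I where "I = max K (nat (m X2 - Q v))"
    have I: "K \<le> I" "m X2 - int I \<le> Q v"
      by (simp_all add: I_def)
    have "mode phi2 v q (single w) = 0" if "q < m X2 - int I" for q
      by (rule Q[of _ v]) (use that I in linarith)
    from product_side[OF I(1) this] show ?thesis
      by (simp only: iterate_side res[OF I(2)])
  qed
  then show "\<exists>k>0. \<forall>v.
     fmul (cscale act) (taylor (binpow 1 X0 X2) nu (int k))
       (vop_series act V Y (vop act V Y u (xpow X0) (\<lambda>s. phi1 s - phi2 s) (const v)) (xpow X2) phi2 (const w))
     = fmul (cscale act) (taylor (binpow 1 X0 X2) nu (int k))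
        (vop act V Y u (taylor (binpow 1 X0 X2) nu) phi1 (vop act V Y v (xpow X2) phi2 (const w)))"
    using K by (intro exI[of _ K]) (simp add: fun_eq_iff)
qed

end

text \<open>The second conjunct expresses that weak associativity follows from truncation and the
  Jacobi identity; the first is its instance for a full
  \<open>N2_vertex_superalgebra\<close>.\<close>

theorem proposition3p2:
  fixes L :: enat
    and act :: "grassmann \<Rightarrow> 'v::ab_group_add \<Rightarrow> 'v"
    and V :: "bit \<Rightarrow> 'v set"
    and Y :: "'v vertex_map"
    and vac :: 'v
  shows "(N2_vertex_superalgebra L act V Y vac \<longrightarrow> weak_associativity act V Y) \<and>
    (N2_vertex_data L act V Y \<and> truncation Y \<and> jacobi_identity act V Y \<longrightarrow>
      weak_associativity act V Y)"
  unfolding N2_vertex_superalgebra_def N2_vertex_superalgebra_axioms_def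
  using N2_vertex_data.weak_associativity_of_jacobi by blast

end
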